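(* Suppose that the building set $\mathcal{G}$ is $\mathrm{Aut}(\Phi)$-invariant. Then $\mathrm{Aut}(\Phi)$ is a subgroup of $\mathrm{Aut}(P_{\mathcal{G}}(\Phi))$. If moreover every element of $\mathrm{Aut}(P_{\mathcal{G}}(\Phi))$ leaves invariant the set of polytopes $\{wP_{\mathcal{G}_{fund}}:w\in W\}$, then $\mathrm{Aut}(\Phi)=\mathrm{Aut}(P_{\mathcal{G}}(\Phi))$.
   Context: $V$ is a real Euclidean space of dimension $n$ with inner product $(\cdot,\cdot)$; $\Phi\subset V$ a root system spanning $V$ with finite Weyl group $W$, simple roots $\Delta$, positive roots $\Phi^+$. Normalization: if $\Phi$ has two or more irreducible components, all short roots have the same length (in a component whose roots all have the same length, they count as short). $\mathrm{Aut}(\Phi)$ is the group of linear automorphisms of $V$ mapping $\Phi$ onto itself (isometries under this normalization); $\mathrm{Aut}(P)$ is the group of isometries of $V$ mapping $P$ onto itself. For a subspace $A$ spanned by roots, $\pi_A=\frac12\sum_{\alpha\in\Phi^+\cap A}\alpha$; $\delta=\pi_V$; $\delta_A=\delta-\pi_A$ for $A\ne V$. A building set $\mathcal{G}\subseteq\mathcal{C}_\Phi$ (subspaces spanned by nonempty subsets of $\Phi$) contains all lines $\langle\alpha\rangle$, $\alpha\in\Phi$, and every $C\in\mathcal{C}_\Phi$ is the direct sum of the maximal elements of $\mathcal{G}$ contained in $C$; $\mathcal{G}$ is $W$-invariant with $V\in\mathcal{G}$. $\mathcal{G}_{fund}$ = elements of $\mathcal{G}$ spanned by subsets of $\Delta$;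 $\mathcal{C}_{fund}$ = subspaces spanned by nonempty subsets of $\Delta$. Fix a suitable list: with $R^A_B=p/q$ for $B\subsetneq A$ in $\mathcal{G}_{fund}$ ($p$ maximal coefficient of $\pi_A$, $q$ minimal coefficient of $\pi_B$ over simple roots in $B$, w.r.t. $\Delta$) and $R^i_j=\max R^A_B$ over $\dim A=i,\dim B=j$, reals $0<\epsilon_1<\dots<\epsilon_n=a$ with $\epsilon_i>2R^i_{i-1}\epsilon_{i-1}$. $H_V=\{(x,\delta)=a\}$, $HS_V=\{(x,\delta)\le a\}$; $HS_A=\{(x,\delta_A)\le a-\epsilon_{\dim A}\}$ for $A\in\mathcal{G}_{fund}\setminus\{V\}$; for $C\in\mathcal{C}_{fund}\setminus\mathcal{G}_{fund}$ with $\mathcal{G}_{fund}$-decomposition $C=C_1\oplus\dots\oplus C_r$ (maximal elements of $\mathcal{G}_{fund}$ in $C$), $\delta_C=\delta-\sum\pi_{C_i}$ and $\overline{HS}_C$ is the closed half-space bounded by $\{(x,\delta_C)=a-\sum\epsilon_{\dim C_i}\}$ containing the origin. $P_{\mathcal{G}_{fund}}=H_V\cap\bigcap_{A\in\mathcal{G}_{fund}\setminus\{V\}}HS_A$; $P_{\mathcal{G}}(\Phi)=\bigcap_{\sigma\in W}\big(\bigcap_{A\in\mathcal{G}_{fund}}\sigma HS_A\cap\bigcap_{C\in\mathcal{C}_{fund}\setminus\mathcal{G}_{fund}}\sigma\overline{HS}_C\big)$.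
   Formalization: When no pair B ⊊ A in G_fund has dimensions i−1 and i, the maximum R^i_{i−1} is undefined; it is taken to be 1, so ε_i > 2ε_{i−1} is required. With no condition there the claim fails, e.g. for A_1^4 with G = {lines, V} and ε = (0.6, 0.7, 0.8, 1). *)

theory Defs
  imports "HOL-Analysis.Analysis" "HOL-Algebra.Group"
begin

section \<open>Root systems\<close>

definition reflection :: "'a::euclidean_space \<Rightarrow> 'a \<Rightarrow> 'a" where
  "reflection \<alpha> x = x - (2 * (x \<bullet> \<alpha>) / (\<alpha> \<bullet> \<alpha>)) *\<^sub>R \<alpha>"

text \<open>Root systems are reduced and crystallographic, and span the ambient space.\<close>

definition root_system :: "'a::euclidean_space set \<Rightarrow> bool" where
  "root_system \<Phi> \<longleftrightarrow>
     finite \<Phi> \<and> 0 \<notin> \<Phi> \<and> span \<Phi> = UNIV \<and>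
     (\<forall>\<alpha>\<in>\<Phi>. reflection \<alpha> ` \<Phi> = \<Phi>) \<and>
     (\<forall>\<alpha>\<in>\<Phi>. \<forall>\<beta>\<in>\<Phi>. 2 * (\<beta> \<bullet> \<alpha>) / (\<alpha> \<bullet> \<alpha>) \<in> \<int>) \<and>
     (\<forall>\<alpha>\<in>\<Phi>. \<forall>c::real. c *\<^sub>R \<alpha> \<in> \<Phi> \<longrightarrow> c = 1 \<or> c = -1)"

definition irreducible_roots :: "'a::euclidean_space set \<Rightarrow> bool" where
  "irreducible_roots \<Psi> \<longleftrightarrow>
     \<Psi> \<noteq> {} \<and>
     \<not> (\<exists>\<Psi>1 \<Psi>2. \<Psi>1 \<noteq> {} \<and> \<Psi>2 \<noteq> {} \<and> \<Psi>1 \<inter> \<Psi>2 = {} \<and> \<Psi> = \<Psi>1 \<union> \<Psi>2 \<and>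
           (\<forall>\<alpha>\<in>\<Psi>1. \<forall>\<beta>\<in>\<Psi>2. orthogonal \<alpha> \<beta>))"

definition irreducible_component :: "'a::euclidean_space set \<Rightarrow> 'a set \<Rightarrow> bool" where
  "irreducible_component \<Phi> \<Psi> \<longleftrightarrow>
     \<Psi> \<subseteq> \<Phi> \<and> irreducible_roots \<Psi> \<and> (\<forall>\<alpha>\<in>\<Psi>. \<forall>\<beta>\<in>\<Phi> - \<Psi>. orthogonal \<alpha> \<beta>)"

definition short_roots :: "'a::euclidean_space set \<Rightarrow> 'a set" where
  "short_roots \<Phi> =
     {\<alpha>. \<exists>\<Psi>. irreducible_component \<Phi> \<Psi> \<and> \<alpha> \<in> \<Psi> \<and> (\<forall>\<beta>\<in>\<Psi>. norm \<alpha> \<le> norm \<beta>)}"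

definition normalized_roots :: "'a::euclidean_space set \<Rightarrow> bool" where
  "normalized_roots \<Phi> \<longleftrightarrow>
     ((\<exists>\<Psi>1 \<Psi>2. irreducible_component \<Phi> \<Psi>1 \<and> irreducible_component \<Phi> \<Psi>2 \<and> \<Psi>1 \<noteq> \<Psi>2) \<longrightarrow>
      (\<forall>\<alpha>\<in>short_roots \<Phi>. \<forall>\<beta>\<in>short_roots \<Phi>. norm \<alpha> = norm \<beta>))"

text \<open>Reflections are involutions, so inverses need no separate clause.\<close>

inductive_set weyl_group :: "('a::euclidean_space) set \<Rightarrow> ('a \<Rightarrow> 'a) set" for \<Phi> where
  weyl_id: "id \<in> weyl_group \<Phi>"
| weyl_step: "w \<in> weyl_group \<Phi> \<Longrightarrow> \<alpha> \<in> \<Phi> \<Longrightarrow> reflection \<alpha> \<circ> w \<in> weyl_group \<Phi>"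

text \<open>For a basis \<open>\<Delta>\<close>, the library's \<open>representation \<Delta> \<beta> \<alpha>\<close> is the coefficient of \<open>\<alpha>\<close> in \<open>\<beta>\<close>.\<close>

definition simple_roots :: "'a::euclidean_space set \<Rightarrow> 'a set \<Rightarrow> bool" where
  "simple_roots \<Phi> \<Delta> \<longleftrightarrow>
     \<Delta> \<subseteq> \<Phi> \<and> independent \<Delta> \<and> span \<Delta> = UNIV \<and>
     (\<forall>\<beta>\<in>\<Phi>. (\<forall>\<alpha>\<in>\<Delta>. representation \<Delta> \<beta> \<alpha> \<in> \<int>) \<and>
            ((\<forall>\<alpha>\<in>\<Delta>. representation \<Delta> \<beta> \<alpha> \<ge> 0) \<or> (\<forall>\<alpha>\<in>\<Delta>. representation \<Delta> \<beta> \<alpha> \<le> 0)))"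

definition positive_roots :: "'a::euclidean_space set \<Rightarrow> 'a set \<Rightarrow> 'a set" where
  "positive_roots \<Phi> \<Delta> = {\<beta>\<in>\<Phi>. \<forall>\<alpha>\<in>\<Delta>. representation \<Delta> \<beta> \<alpha> \<ge> 0}"

definition Aut_roots :: "'a::euclidean_space set \<Rightarrow> ('a \<Rightarrow> 'a) set" where
  "Aut_roots \<Phi> = {f. linear f \<and> bij f \<and> f ` \<Phi> = \<Phi>}"

text \<open>Isometries are arbitrary distance-preserving bijections; they are not required to fix the
  origin.\<close>

definition isometry_group :: "'a::euclidean_space set \<Rightarrow> ('a \<Rightarrow> 'a) monoid" where
  "isometry_group P =
     \<lparr>carrier = {f. bij f \<and> (\<forall>x y. dist (f x) (f y) = dist x y) \<and> f ` P = P},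
      monoid.mult = (\<circ>), one = id\<rparr>"

lemma group_isometry_group: "group (isometry_group P)"
proof (rule groupI)
  fix f assume f: "f \<in> carrier (isometry_group P)"
  then have b: "bij f" and d: "\<And>x y. dist (f x) (f y) = dist x y" and P: "f ` P = P"
    by (auto simp: isometry_group_def)
  define g where "g = inv_into UNIV f"
  have fg: "f (g x) = x" for x
    using b by (simp add: g_def bij_is_surj surj_f_inv_f)
  have gf: "g (f x) = x" for x
    using b by (simp add: g_def bij_is_inj)
  have "dist (g x) (g y) = dist x y" for x y
    using d[of "g x" "g y"] by (simp add: fg)
  moreover have "g ` P = P"
    using P b by (metis g_def bij_is_inj image_inv_f_f)
  moreover have "bij g"
    using b by (simp add: g_def bij_imp_bij_inv)
  moreover have "g \<circ> f = id"
    using gf by auto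
  ultimately show "\<exists>g\<in>carrier (isometry_group P). g \<otimes>\<^bsub>isometry_group P\<^esub> f = \<one>\<^bsub>isometry_group P\<^esub>"
    by (auto simp: isometry_group_def intro!: exI[of _ g])
qed (simp_all add: isometry_group_def o_assoc bij_comp image_comp[symmetric] del: o_apply image_comp, simp_all)


section \<open>Building sets\<close>

definition root_subspaces :: "'a::euclidean_space set \<Rightarrow> 'a set set" where
  "root_subspaces \<Phi> = {span S | S. S \<noteq> {} \<and> S \<subseteq> \<Phi>}"

definition is_direct_sum :: "'a::euclidean_space set \<Rightarrow> 'a set set \<Rightarrow> bool" where
  "is_direct_sum C \<U> \<longleftrightarrow>
     C = span (\<Union>\<U>) \<and> (\<forall>U\<in>\<U>. U \<inter> span (\<Union>(\<U> - {U})) = {0})"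

definition max_elements :: "'a set set \<Rightarrow> 'a set \<Rightarrow> 'a set set" where
  "max_elements \<G> C = {A\<in>\<G>. A \<subseteq> C \<and> (\<forall>B\<in>\<G>. B \<subseteq> C \<and> A \<subseteq> B \<longrightarrow> A = B)}"

definition building_set :: "'a::euclidean_space set \<Rightarrow> 'a set set \<Rightarrow> bool" where
  "building_set \<Phi> \<G> \<longleftrightarrow>
     \<G> \<subseteq> root_subspaces \<Phi> \<and>
     (\<forall>\<alpha>\<in>\<Phi>. span {\<alpha>} \<in> \<G>) \<and>
     (\<forall>C\<in>root_subspaces \<Phi>. is_direct_sum C (max_elements \<G> C))"

definition invariant_under :: "('a \<Rightarrow> 'a) set \<Rightarrow> 'a set set \<Rightarrow> bool" where
  "invariant_under H \<G> \<longleftrightarrow> (\<forall>f\<in>H. \<forall>A\<in>\<G>. f ` A \<in> \<G>)"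

definition G_fund :: "'a::euclidean_space set \<Rightarrow> 'a set set \<Rightarrow> 'a set set" where
  "G_fund \<Delta> \<G> = {A\<in>\<G>. \<exists>S\<subseteq>\<Delta>. A = span S}"

definition C_fund :: "'a::euclidean_space set \<Rightarrow> 'a set set" where
  "C_fund \<Delta> = {span S | S. S \<noteq> {} \<and> S \<subseteq> \<Delta>}"


section \<open>Suitable lists\<close>

definition pi_sub :: "'a::euclidean_space set \<Rightarrow> 'a set \<Rightarrow> 'a set \<Rightarrow> 'a" where
  "pi_sub \<Phi> \<Delta> A = (1/2) *\<^sub>R (\<Sum>\<alpha>\<in>positive_roots \<Phi> \<Delta> \<inter> A. \<alpha>)"

definition delta :: "'a::euclidean_space set \<Rightarrow> 'a set \<Rightarrow> 'a" where
  "delta \<Phi> \<Delta> = pi_sub \<Phi> \<Delta> UNIV"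

definition ratio :: "'a::euclidean_space set \<Rightarrow> 'a set \<Rightarrow> 'a set \<Rightarrow> 'a set \<Rightarrow> real" where
  "ratio \<Phi> \<Delta> A B =
     Max (representation \<Delta> (pi_sub \<Phi> \<Delta> A) ` \<Delta>) /
     Min (representation \<Delta> (pi_sub \<Phi> \<Delta> B) ` (\<Delta> \<inter> B))"

definition ratios :: "'a::euclidean_space set \<Rightarrow> 'a set \<Rightarrow> 'a set set \<Rightarrow> nat \<Rightarrow> nat \<Rightarrow> real set" where
  "ratios \<Phi> \<Delta> \<G> i j =
     {ratio \<Phi> \<Delta> A B | A B. A \<in> G_fund \<Delta> \<G> \<and> B \<in> G_fund \<Delta> \<G> \<and> B \<subset> A \<and> dim A = i \<and> dim B = j}"

text \<open>There may be no pair \<open>B \<subset> A\<close> of dimensions \<open>j\<close>, \<open>i\<close>, e.g. if \<open>\<G>\<close> consists of the lines and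
  the whole space for a root system of type \<open>A\<^sub>1\<^sup>n\<close>, \<open>n \<ge> 3\<close>. In that case the maximum is taken to
  be 1, which is a lower bound of all ratios because \<open>\<pi>\<^sub>B\<close> is coefficientwise at most \<open>\<pi>\<^sub>A\<close>.
  Imposing no condition instead would allow empty \<open>P_fund\<close> below: in type \<open>A\<^sub>1\<^sup>4\<close> with this \<open>\<G>\<close>,
  the list 0.6, 0.7, 0.8, 1 would turn the permutonestohedron into a 24-cell, with more isometries
  than \<open>\<Phi>\<close> has automorphisms.\<close>

definition max_ratio :: "'a::euclidean_space set \<Rightarrow> 'a set \<Rightarrow> 'a set set \<Rightarrow> nat \<Rightarrow> nat \<Rightarrow> real" where
  "max_ratio \<Phi> \<Delta> \<G> i j = (if ratios \<Phi> \<Delta> \<G> i j = {} then 1 else Max (ratios \<Phi> \<Delta> \<G> i j))"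

definition suitable_list ::
  "'a::euclidean_space set \<Rightarrow> 'a set \<Rightarrow> 'a set set \<Rightarrow> (nat \<Rightarrow> real) \<Rightarrow> real \<Rightarrow> bool" where
  "suitable_list \<Phi> \<Delta> \<G> \<epsilon> a \<longleftrightarrow>
     0 < \<epsilon> 1 \<and> (\<forall>i\<in>{1..<DIM('a)}. \<epsilon> i < \<epsilon> (Suc i)) \<and> \<epsilon> DIM('a) = a \<and>
     (\<forall>i\<in>{2..DIM('a)}. \<epsilon> i > 2 * max_ratio \<Phi> \<Delta> \<G> i (i - 1) * \<epsilon> (i - 1))"


section \<open>Nestohedra and the permutonestohedron\<close>

text \<open>Since \<open>\<epsilon> DIM('a) = a\<close>, the case \<open>A = UNIV\<close> is not an instance of the general formula.\<close>

definition HS ::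
  "'a::euclidean_space set \<Rightarrow> 'a set \<Rightarrow> (nat \<Rightarrow> real) \<Rightarrow> real \<Rightarrow> 'a set \<Rightarrow> 'a set" where
  "HS \<Phi> \<Delta> \<epsilon> a A =
     (if A = UNIV then {x. x \<bullet> delta \<Phi> \<Delta> \<le> a}
      else {x. x \<bullet> (delta \<Phi> \<Delta> - pi_sub \<Phi> \<Delta> A) \<le> a - \<epsilon> (dim A)})"

definition halfspace_origin :: "'a::euclidean_space \<Rightarrow> real \<Rightarrow> 'a set" where
  "halfspace_origin v c = (if 0 \<le> c then {x. x \<bullet> v \<le> c} else {x. x \<bullet> v \<ge> c})"

definition HS_bar ::
  "'a::euclidean_space set \<Rightarrow> 'a set \<Rightarrow> 'a set set \<Rightarrow> (nat \<Rightarrow> real) \<Rightarrow> real \<Rightarrow> 'a set \<Rightarrow> 'a set" where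
  "HS_bar \<Phi> \<Delta> \<G> \<epsilon> a C =
     halfspace_origin
       (delta \<Phi> \<Delta> - (\<Sum>D\<in>max_elements (G_fund \<Delta> \<G>) C. pi_sub \<Phi> \<Delta> D))
       (a - (\<Sum>D\<in>max_elements (G_fund \<Delta> \<G>) C. \<epsilon> (dim D)))"

definition P_fund ::
  "'a::euclidean_space set \<Rightarrow> 'a set \<Rightarrow> 'a set set \<Rightarrow> (nat \<Rightarrow> real) \<Rightarrow> real \<Rightarrow> 'a set" where
  "P_fund \<Phi> \<Delta> \<G> \<epsilon> a =
     {x. x \<bullet> delta \<Phi> \<Delta> = a} \<inter> (\<Inter>A\<in>G_fund \<Delta> \<G> - {UNIV}. HS \<Phi> \<Delta> \<epsilon> a A)"

definition permutonestohedron ::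
  "'a::euclidean_space set \<Rightarrow> 'a set \<Rightarrow> 'a set set \<Rightarrow> (nat \<Rightarrow> real) \<Rightarrow> real \<Rightarrow> 'a set" where
  "permutonestohedron \<Phi> \<Delta> \<G> \<epsilon> a =
     (\<Inter>\<sigma>\<in>weyl_group \<Phi>.
        (\<Inter>A\<in>G_fund \<Delta> \<G>. \<sigma> ` HS \<Phi> \<Delta> \<epsilon> a A) \<inter>
        (\<Inter>C\<in>C_fund \<Delta> - G_fund \<Delta> \<G>. \<sigma> ` HS_bar \<Phi> \<Delta> \<G> \<epsilon> a C))"

end

theory Submission
  imports Defs
begin

text \<open>
  An automorphism of \<open>\<Phi>\<close> preserves Cartan integers, hence scales each irreducible component, and the
  normalisation forces the factors to be 1. Since \<open>W\<close> is transitive on simple systems, it is the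
  product of a Weyl group element and a diagram automorphism; the latter permutes the half-spaces
  defining the permutonestohedron.

  Conversely, let an isometry \<open>g\<close> permute the polytopes \<open>w P\<close>, \<open>w \<in> W\<close>, where \<open>P\<close> is the fundamental
  nestohedron. The conditions on \<open>\<epsilon>\<close> make \<open>P\<close> span the hyperplane \<open>x \<bullet> \<delta> = a\<close>, so \<open>g\<close> permutes the
  hyperplanes with normal vectors \<open>w \<delta>\<close>. As these vectors sum to 0 and span, \<open>g\<close> fixes the origin,
  so it is linear and permutes the orbit of \<open>\<delta>\<close>. After composition with an element of \<open>W\<close> it fixes
  \<open>\<delta>\<close>; it then preserves the cone generated by the differences \<open>\<delta> - w \<delta>\<close>, whose extremal rays are
  spanned by the simple roots, and therefore permutes the simple roots.
\<close>

section \<open>Reflections and the Weyl group\<close>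

text \<open>Three points need more than their names. An affine hyperplane determines its normal only
  up to sign, and \<open>g\<close> may have a translation part \<open>c\<close>. Comparing equations
  of hyperplanes gives c \<bullet> u \<delta> = (1 - k) a with k = 1 or k = -1 for every u in W.
  These products are nonnegative because a > 0, and the orbit of \<delta> sums to 0, so all of them
  vanish. This removes the translation and the case k = -1 together. Preserving the cone only
  permutes the rays through the simple roots. Lengths are recovered from the sphere containing the
  orbit: since 2 (\<delta> \<bullet> \<alpha>) = \<alpha> \<bullet> \<alpha>, the vector \<delta> -
  t \<alpha> has the norm of \<delta> only for t = 0 and t = 1. The growth condition on \<epsilon>
  compares consecutive dimensions only. An interior point is therefore controlled along chains in
  the building set whose dimension rises by one; adding a simple root that is not orthogonal to the
  current simple roots provides such chains.\<close>

lemma linear_reflection: "linear (reflection \<alpha>)"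
  unfolding reflection_def
  by (rule linearI) (simp_all add: algebra_simps inner_add_left add_divide_distrib)

lemma reflection_self: "reflection \<alpha> \<alpha> = - \<alpha>"
  by (cases "\<alpha> = 0") (simp_all add: reflection_def scaleR_2)

lemma orthogonal_transformation_reflection: "orthogonal_transformation (reflection \<alpha>)"
  unfolding orthogonal_transformation_def
proof (intro conjI allI linear_reflection)
  fix v w
  show "reflection \<alpha> v \<bullet> reflection \<alpha> w = v \<bullet> w"
    by (cases "\<alpha> = 0")
      (simp_all add: reflection_def inner_diff_left inner_diff_right inner_commute field_simps)
qed

lemma reflection_involution: "reflection \<alpha> (reflection \<alpha> x) = x"
proof (cases "\<alpha> = 0")
  case False
  then have "2 * (reflection \<alpha> x \<bullet> \<alpha>) / (\<alpha> \<bullet> \<alpha>) = - (2 * (x \<bullet> \<alpha>) / (\<alpha> \<bullet> \<alpha>))"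
    by (simp add: reflection_def inner_diff_left)
  then show ?thesis
    by (subst reflection_def) (simp add: reflection_def[of \<alpha> x])
qed (simp add: reflection_def)

lemma inner_reflection: "reflection \<alpha> x \<bullet> y = x \<bullet> reflection \<alpha> y"
  by (simp add: reflection_def inner_diff_left inner_diff_right inner_commute)

lemma orthogonal_transformation_inner:
  "orthogonal_transformation f \<Longrightarrow> f x \<bullet> f y = x \<bullet> y"
  by (simp add: orthogonal_transformation_def)

lemma Aut_rootsD:
  assumes "f \<in> Aut_roots \<Phi>"
  shows "linear f" "bij f" "f ` \<Phi> = \<Phi>" "\<And>\<alpha>. f \<alpha> \<in> \<Phi> \<longleftrightarrow> \<alpha> \<in> \<Phi>"
proof -
  show f: "linear f" "bij f" "f ` \<Phi> = \<Phi>"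
    using assms by (auto simp: Aut_roots_def)
  show "f \<alpha> \<in> \<Phi> \<longleftrightarrow> \<alpha> \<in> \<Phi>" for \<alpha>
    using f by (metis bij_is_inj inj_image_mem_iff)
qed

lemma Aut_roots_comp: "f \<in> Aut_roots \<Phi> \<Longrightarrow> g \<in> Aut_roots \<Phi> \<Longrightarrow> f \<circ> g \<in> Aut_roots \<Phi>"
  unfolding Aut_roots_def
  by (metis (mono_tags, lifting) bij_comp image_comp linear_compose mem_Collect_eq)

lemma Aut_roots_inv:
  assumes "f \<in> Aut_roots \<Phi>"
  shows "inv_into UNIV f \<in> Aut_roots \<Phi>"
proof -
  note f = Aut_rootsD[OF assms]
  have "linear (inv_into UNIV f)"
    using f by (metis bij_is_inj inj_linear_imp_inv_linear)
  moreover have "inv_into UNIV f ` \<Phi> = \<Phi>"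
    using f by (metis bij_is_inj image_inv_f_f)
  ultimately show ?thesis
    using f by (simp add: Aut_roots_def bij_imp_bij_inv)
qed

lemma weyl_group_comp:
  assumes "w \<in> weyl_group \<Phi>" "u \<in> weyl_group \<Phi>"
  shows "w \<circ> u \<in> weyl_group \<Phi>"
  using assms(1)
proof induction
  case (weyl_step w \<alpha>)
  then show ?case
    by (metis o_assoc weyl_group.weyl_step)
qed (simp add: assms(2))

lemma reflection_in_weyl_group: "\<alpha> \<in> \<Phi> \<Longrightarrow> reflection \<alpha> \<in> weyl_group \<Phi>"
  using weyl_group.weyl_step[OF weyl_group.weyl_id, of \<alpha> \<Phi>] by simp

lemma orthogonal_transformation_weyl:
  "w \<in> weyl_group \<Phi> \<Longrightarrow> orthogonal_transformation w"
proof (induction rule: weyl_group.induct)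
  case weyl_id
  then show ?case by (simp add: id_def)
next
  case (weyl_step w \<alpha>)
  then show ?case
    by (intro orthogonal_transformation_compose orthogonal_transformation_reflection)
qed

lemma weyl_group_inv:
  assumes "w \<in> weyl_group \<Phi>"
  shows "inv_into UNIV w \<in> weyl_group \<Phi>"
  using assms
proof induction
  case weyl_id
  show ?case
    using weyl_group.weyl_id[of \<Phi>] by (simp add: inv_id[unfolded id_def] id_def)
next
  case (weyl_step w \<alpha>)
  have "reflection \<alpha> \<circ> reflection \<alpha> = id"
    by (simp add: fun_eq_iff reflection_involution)
  then have "inv_into UNIV (reflection \<alpha>) = reflection \<alpha>"
    by (metis inv_unique_comp)
  moreover have "inv_into UNIV (reflection \<alpha> \<circ> w) = inv_into UNIV w \<circ> inv_into UNIV (reflection \<alpha>)"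
    by (intro o_inv_distrib orthogonal_transformation_bij orthogonal_transformation_reflection
        orthogonal_transformation_weyl[OF weyl_step.hyps(1)])
  ultimately show ?case
    using weyl_step by (metis weyl_group_comp reflection_in_weyl_group)
qed

lemma weyl_group_Aut_roots:
  assumes "root_system \<Phi>" "w \<in> weyl_group \<Phi>"
  shows "w \<in> Aut_roots \<Phi>"
proof -
  have "w ` \<Phi> = \<Phi>"
    using assms(2)
  proof induction
    case (weyl_step w \<alpha>)
    then show ?case
      using assms(1) by (metis image_comp root_system_def)
  qed simp
  then show ?thesis
    using orthogonal_transformation_weyl[OF assms(2)]
    by (simp add: Aut_roots_def orthogonal_transformation_linear orthogonal_transformation_bij)
qed


section \<open>Automorphisms are isometries\<close>

definition cartan :: "'a::euclidean_space \<Rightarrow> 'a \<Rightarrow> real" where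
  "cartan \<beta> \<alpha> = 2 * (\<beta> \<bullet> \<alpha>) / (\<alpha> \<bullet> \<alpha>)"

lemma root_systemD:
  assumes "root_system \<Phi>"
  shows "finite \<Phi>" "0 \<notin> \<Phi>" "span \<Phi> = UNIV"
    "\<And>\<alpha> \<beta>. \<alpha> \<in> \<Phi> \<Longrightarrow> \<beta> \<in> \<Phi> \<Longrightarrow> reflection \<alpha> \<beta> \<in> \<Phi>"
    "\<And>\<alpha> c. \<alpha> \<in> \<Phi> \<Longrightarrow> c *\<^sub>R \<alpha> \<in> \<Phi> \<Longrightarrow> c = 1 \<or> c = -1"
    "\<And>\<alpha>. \<alpha> \<in> \<Phi> \<Longrightarrow> - \<alpha> \<in> \<Phi>"
proof -
  show *: "finite \<Phi>" "0 \<notin> \<Phi>" "span \<Phi> = UNIV"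
    "\<And>\<alpha> \<beta>. \<alpha> \<in> \<Phi> \<Longrightarrow> \<beta> \<in> \<Phi> \<Longrightarrow> reflection \<alpha> \<beta> \<in> \<Phi>"
    "\<And>\<alpha> c. \<alpha> \<in> \<Phi> \<Longrightarrow> c *\<^sub>R \<alpha> \<in> \<Phi> \<Longrightarrow> c = 1 \<or> c = -1"
    using assms unfolding root_system_def by blast+
  show "- \<alpha> \<in> \<Phi>" if "\<alpha> \<in> \<Phi>" for \<alpha>
    using *(4)[OF that that] by (simp add: reflection_self)
qed

text \<open>Composing the reflection in \<open>f \<alpha>\<close> with the conjugate by \<open>f\<close> of the reflection in \<open>\<alpha>\<close> gives a
  transvection along \<open>f \<alpha>\<close> which preserves the finite set of roots, hence is trivial.\<close>

lemma cartan_Aut_roots: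
  assumes \<Phi>: "root_system \<Phi>" and f: "f \<in> Aut_roots \<Phi>" and \<alpha>: "\<alpha> \<in> \<Phi>" and \<beta>: "\<beta> \<in> \<Phi>"
  shows "cartan (f \<beta>) (f \<alpha>) = cartan \<beta> \<alpha>"
proof (rule ccontr)
  note R = root_systemD[OF \<Phi>] and F = Aut_rootsD[OF f]
  define m where "m = cartan (f \<beta>) (f \<alpha>) - cartan \<beta> \<alpha>"
  assume "\<not> ?thesis"
  then have m: "m \<noteq> 0" by (simp add: m_def)
  have nz: "\<alpha> \<bullet> \<alpha> \<noteq> 0" "f \<alpha> \<bullet> f \<alpha> \<noteq> 0" "f \<alpha> \<noteq> 0"
    using \<alpha> R F by auto
  \<comment> \<open>Reflecting in \<alpha>, applying \<open>f\<close>, reflecting in f \<alpha> and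
    undoing \<open>f\<close> leads back to the line through \<beta> in direction \<alpha>, displaced
    by -m.\<close>
  have step: "\<beta> + (c - m) *\<^sub>R \<alpha> \<in> \<Phi>" if c: "\<beta> + c *\<^sub>R \<alpha> \<in> \<Phi>" for c
  proof -
    have "reflection \<alpha> (\<beta> + c *\<^sub>R \<alpha>) \<in> \<Phi>"
      using R(4) \<alpha> c by blast
    moreover have "reflection \<alpha> (\<beta> + c *\<^sub>R \<alpha>) = \<beta> - (cartan \<beta> \<alpha> + c) *\<^sub>R \<alpha>"
    proof -
      have "2 * ((\<beta> + c *\<^sub>R \<alpha>) \<bullet> \<alpha>) / (\<alpha> \<bullet> \<alpha>) = cartan \<beta> \<alpha> + 2 * c"
        using nz by (simp add: cartan_def inner_add_left field_simps)
      moreover have "c *\<^sub>R \<alpha> - (cartan \<beta> \<alpha> + 2 * c) *\<^sub>R \<alpha> = - ((cartan \<beta> \<alpha> + c) *\<^sub>R \<alpha>)"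
        by (simp flip: scaleR_minus_left scaleR_left.diff)
      ultimately show ?thesis
        by (simp add: reflection_def)
    qed
    ultimately have "\<beta> - (cartan \<beta> \<alpha> + c) *\<^sub>R \<alpha> \<in> \<Phi>"
      by simp
    then have "reflection (f \<alpha>) (f (\<beta> - (cartan \<beta> \<alpha> + c) *\<^sub>R \<alpha>)) \<in> \<Phi>"
      using R(4) F(4) \<alpha> by blast
    moreover have "reflection (f \<alpha>) (f (\<beta> - (cartan \<beta> \<alpha> + c) *\<^sub>R \<alpha>)) = f (\<beta> + (c - m) *\<^sub>R \<alpha>)"
    proof -
      have "2 * ((f \<beta> - (cartan \<beta> \<alpha> + c) *\<^sub>R f \<alpha>) \<bullet> f \<alpha>) / (f \<alpha> \<bullet> f \<alpha>)
          = cartan (f \<beta>) (f \<alpha>) - 2 * (cartan \<beta> \<alpha> + c)"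
        using nz by (simp add: cartan_def[of "f \<beta>"] inner_diff_left diff_divide_distrib right_diff_distrib)
      moreover have "(c - m) *\<^sub>R y = - ((cartan \<beta> \<alpha> + c) *\<^sub>R y)
          - (cartan (f \<beta>) (f \<alpha>) - 2 * (cartan \<beta> \<alpha> + c)) *\<^sub>R y" for y :: 'a
        by (simp add: m_def flip: scaleR_minus_left scaleR_left.diff)
      ultimately show ?thesis
        using F(1) by (simp add: reflection_def linear_diff linear_add linear_scale linear_neg)
    qed
    ultimately show ?thesis
      using F(4) by simp
  qed
  have "\<beta> + (- (real k * m)) *\<^sub>R \<alpha> \<in> \<Phi>" for k
  proof (induction k)
    case 0
    show ?case using \<beta> by simp
  next
    case (Suc k)
    from step[OF this] show ?case
      by (simp add: algebra_simps)
  qed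
  then have "range (\<lambda>k::nat. \<beta> + (- (real k * m)) *\<^sub>R \<alpha>) \<subseteq> \<Phi>"
    by blast
  moreover have "inj (\<lambda>k::nat. \<beta> + (- (real k * m)) *\<^sub>R \<alpha>)"
    using m nz by (auto simp: inj_def)
  ultimately show False
    using R(1) by (meson finite_subset infinite_UNIV_nat finite_imageD)
qed

section \<open>Scaling factors on irreducible components\<close>

lemma orthogonal_Aut_roots:
  assumes "root_system \<Phi>" "f \<in> Aut_roots \<Phi>" "\<alpha> \<in> \<Phi>" "\<beta> \<in> \<Phi>"
  shows "orthogonal (f \<alpha>) (f \<beta>) \<longleftrightarrow> orthogonal \<alpha> \<beta>"
proof -
  have "\<beta> \<noteq> 0" "f \<beta> \<noteq> 0"
    using assms root_systemD(2)[OF assms(1)] Aut_rootsD(4)[OF assms(2)] by metis+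
  then show ?thesis
    using cartan_Aut_roots[OF assms(1,2,4,3)] by (auto simp: cartan_def orthogonal_def)
qed

text \<open>Each of the two Cartan equalities expresses one squared scaling factor as (f \<alpha>
  \<bullet> f \<beta>) / (\<alpha> \<bullet> \<beta>), which is symmetric in the two roots.
  Non-orthogonality is what permits the division.\<close>

lemma norm_ratio_Aut_roots:
  assumes \<Phi>: "root_system \<Phi>" and f: "f \<in> Aut_roots \<Phi>" and \<alpha>: "\<alpha> \<in> \<Phi>" and \<beta>: "\<beta> \<in> \<Phi>"
    and no: "\<not> orthogonal \<alpha> \<beta>"
  shows "norm (f \<alpha>) / norm \<alpha> = norm (f \<beta>) / norm \<beta>"
proof -
  have nz: "\<alpha> \<noteq> 0" "\<beta> \<noteq> 0" "f \<alpha> \<noteq> 0" "f \<beta> \<noteq> 0"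
    using \<alpha> \<beta> root_systemD(2)[OF \<Phi>] Aut_rootsD(4)[OF f] by metis+
  have ip: "\<alpha> \<bullet> \<beta> \<noteq> 0" "f \<alpha> \<bullet> f \<beta> \<noteq> 0"
    using no orthogonal_Aut_roots[OF \<Phi> f \<alpha> \<beta>] by (auto simp: orthogonal_def)
  have "(f \<alpha> \<bullet> f \<beta>) / (f \<beta> \<bullet> f \<beta>) = (\<alpha> \<bullet> \<beta>) / (\<beta> \<bullet> \<beta>)"
    "(f \<alpha> \<bullet> f \<beta>) / (f \<alpha> \<bullet> f \<alpha>) = (\<alpha> \<bullet> \<beta>) / (\<alpha> \<bullet> \<alpha>)"
    using cartan_Aut_roots[OF \<Phi> f \<alpha> \<beta>] cartan_Aut_roots[OF \<Phi> f \<beta> \<alpha>]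
    by (simp_all add: cartan_def inner_commute)
  then have "(f \<alpha> \<bullet> f \<alpha>) / (\<alpha> \<bullet> \<alpha>) = (f \<alpha> \<bullet> f \<beta>) / (\<alpha> \<bullet> \<beta>)"
    "(f \<beta> \<bullet> f \<beta>) / (\<beta> \<bullet> \<beta>) = (f \<alpha> \<bullet> f \<beta>) / (\<alpha> \<bullet> \<beta>)"
    using nz ip by (simp_all add: frac_eq_eq mult.commute)
  then have "(norm (f \<alpha>) / norm \<alpha>)\<^sup>2 = (norm (f \<beta>) / norm \<beta>)\<^sup>2"
    by (simp add: power_divide power2_norm_eq_inner)
  then show ?thesis
    by (simp add: power2_eq_iff_nonneg)
qed

text \<open>The non-orthogonality graph. For the full set of roots its classes are irreducible
  components; for the simple roots they carry the weights of the interior point.\<close>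

definition linked :: "'a::euclidean_space set \<Rightarrow> ('a \<times> 'a) set" where
  "linked S = {(\<alpha>, \<beta>). \<alpha> \<in> S \<and> \<beta> \<in> S \<and> \<not> orthogonal \<alpha> \<beta>}"

lemma sym_linked: "sym (linked S)"
  by (auto simp: sym_def linked_def orthogonal_commute)

lemma linked_class_subset: "\<alpha> \<in> S \<Longrightarrow> (linked S)\<^sup>* `` {\<alpha>} \<subseteq> S"
proof -
  assume \<alpha>: "\<alpha> \<in> S"
  have "\<beta> \<in> S" if "(\<alpha>, \<beta>) \<in> (linked S)\<^sup>*" for \<beta>
    using that by induction (use \<alpha> in \<open>auto simp: linked_def\<close>)
  then show ?thesis by blast
qed

lemma irreducible_rootsI:
  assumes "\<Psi> \<noteq> {}"
    and "\<And>A B. \<lbrakk>A \<noteq> {}; B \<noteq> {}; A \<inter> B = {}; \<Psi> = A \<union> B;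
      \<And>\<alpha> \<beta>. \<alpha> \<in> A \<Longrightarrow> \<beta> \<in> B \<Longrightarrow> orthogonal \<alpha> \<beta>\<rbrakk> \<Longrightarrow> False"
  shows "irreducible_roots \<Psi>"
  using assms unfolding irreducible_roots_def by metis

lemma irreducible_rootsD:
  assumes "irreducible_roots \<Psi>" "\<Psi> = A \<union> B" "A \<inter> B = {}"
    and "\<And>\<alpha> \<beta>. \<alpha> \<in> A \<Longrightarrow> \<beta> \<in> B \<Longrightarrow> orthogonal \<alpha> \<beta>"
  shows "A = {} \<or> B = {}"
  using assms unfolding irreducible_roots_def by metis

text \<open>If the class split into two orthogonal parts, no link would lead out of the part
  containing \<alpha>, so this part would be the whole class.\<close>

lemma irreducible_component_linked_class:
  assumes \<alpha>: "\<alpha> \<in> \<Phi>"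
  shows "irreducible_component \<Phi> ((linked \<Phi>)\<^sup>* `` {\<alpha>})"
proof -
  let ?K = "(linked \<Phi>)\<^sup>* `` {\<alpha>}"
  have K: "?K \<subseteq> \<Phi>" by (rule linked_class_subset[OF \<alpha>])
  have closed: "\<gamma> \<in> ?K" if "\<beta> \<in> ?K" "\<gamma> \<in> \<Phi>" "\<not> orthogonal \<beta> \<gamma>" for \<beta> \<gamma>
    using that K by (auto simp: linked_def intro: rtrancl_into_rtrancl)
  have "irreducible_roots ?K"
  proof (rule irreducible_rootsI)
    fix A B assume AB: "A \<noteq> {}" "B \<noteq> {}" "A \<inter> B = {}" "?K = A \<union> B"
      "\<And>\<alpha> \<beta>. \<alpha> \<in> A \<Longrightarrow> \<beta> \<in> B \<Longrightarrow> orthogonal \<alpha> \<beta>"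
    have all: "\<beta> \<in> X" if "(\<alpha>, \<beta>) \<in> (linked \<Phi>)\<^sup>*" "\<alpha> \<in> X"
      and sep: "\<And>x y. x \<in> X \<Longrightarrow> y \<in> ?K - X \<Longrightarrow> orthogonal x y" for X \<beta>
      using that(1)
    proof induction
      case (step y z)
      then have "z \<in> ?K" by (blast intro: rtrancl_into_rtrancl)
      moreover have "\<not> orthogonal y z" using step by (simp add: linked_def)
      ultimately show ?case using sep step.IH by blast
    qed (fact that(2))
    have "\<alpha> \<in> A \<or> \<alpha> \<in> B" using AB(4) by blast
    moreover have "orthogonal x y" if "x \<in> A" "y \<in> ?K - A" for x y
      using that AB by blast
    moreover have "orthogonal x y" if "x \<in> B" "y \<in> ?K - B" for x y
      using that AB by (metis Diff_iff Un_iff orthogonal_commute)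
    ultimately have "?K \<subseteq> A \<or> ?K \<subseteq> B" using all by blast
    then show False using AB by blast
  qed blast
  then show ?thesis
    unfolding irreducible_component_def using K closed by blast
qed

lemma irreducible_component_image:
  assumes \<Phi>: "root_system \<Phi>" and f: "f \<in> Aut_roots \<Phi>" and \<Psi>: "irreducible_component \<Phi> \<Psi>"
  shows "irreducible_component \<Phi> (f ` \<Psi>)"
proof -
  note F = Aut_rootsD[OF f] and O = orthogonal_Aut_roots[OF \<Phi> f]
  have sub: "\<Psi> \<subseteq> \<Phi>" and irr: "irreducible_roots \<Psi>"
    and orth: "\<And>\<alpha> \<beta>. \<alpha> \<in> \<Psi> \<Longrightarrow> \<beta> \<in> \<Phi> - \<Psi> \<Longrightarrow> orthogonal \<alpha> \<beta>"
    using \<Psi> by (auto simp: irreducible_component_def)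
  have inj: "inj f" using F(2) by (simp add: bij_is_inj)
  have "irreducible_roots (f ` \<Psi>)"
  proof (rule irreducible_rootsI)
    show "f ` \<Psi> \<noteq> {}" using irr by (simp add: irreducible_roots_def)
  next
    fix A B assume AB: "A \<noteq> {}" "B \<noteq> {}" "A \<inter> B = {}" "f ` \<Psi> = A \<union> B"
      "\<And>\<alpha> \<beta>. \<alpha> \<in> A \<Longrightarrow> \<beta> \<in> B \<Longrightarrow> orthogonal \<alpha> \<beta>"
    have surj: "surj f" using F(2) by (rule bij_is_surj)
    have eq: "f ` (f -` A) = A" "f ` (f -` B) = B"
      using surj by (simp_all add: surj_image_vimage_eq)
    have ne: "f -` A \<noteq> {}" "f -` B \<noteq> {}" using AB(1,2) eq by blast+
    have dj: "f -` A \<inter> f -` B = {}" using AB(3) by blast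
    have un: "\<Psi> = f -` A \<union> f -` B"
      using AB(4) inj by (metis inj_vimage_image_eq vimage_Un)
    have "orthogonal \<alpha> \<beta>" if "\<alpha> \<in> f -` A" "\<beta> \<in> f -` B" for \<alpha> \<beta>
      using that un sub O AB(5) by (metis UnCI subsetD vimageD)
    with irreducible_rootsD[OF irr un dj] show False
      using ne by blast
  qed
  moreover have "f ` \<Psi> \<subseteq> \<Phi>" using sub F(3) by blast
  moreover have "orthogonal x y" if xy: "x \<in> f ` \<Psi>" "y \<in> \<Phi> - f ` \<Psi>" for x y
  proof -
    obtain \<alpha> where "x = f \<alpha>" "\<alpha> \<in> \<Psi>" using xy(1) by blast
    moreover obtain \<beta> where "y = f \<beta>" "\<beta> \<in> \<Phi> - \<Psi>" using xy(2) F(3) by blast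
    ultimately show ?thesis using O orth sub by blast
  qed
  ultimately show ?thesis by (simp add: irreducible_component_def)
qed

text \<open>Roots with different scaling factors are orthogonal by
  \<open>norm_ratio_Aut_roots\<close>, so collecting the roots with the factor of \<alpha> would
  split the component.\<close>

lemma norm_ratio_const:
  assumes \<Phi>: "root_system \<Phi>" and f: "f \<in> Aut_roots \<Phi>" and \<Psi>: "irreducible_component \<Phi> \<Psi>"
    and \<alpha>: "\<alpha> \<in> \<Psi>" and \<beta>: "\<beta> \<in> \<Psi>"
  shows "norm (f \<alpha>) / norm \<alpha> = norm (f \<beta>) / norm \<beta>"
proof (rule ccontr)
  let ?c = "\<lambda>\<beta>. norm (f \<beta>) / norm \<beta>"
  assume ne: "?c \<alpha> \<noteq> ?c \<beta>"
  have sub: "\<Psi> \<subseteq> \<Phi>" using \<Psi> by (auto simp: irreducible_component_def)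
  have un: "\<Psi> = {\<gamma>\<in>\<Psi>. ?c \<gamma> = ?c \<alpha>} \<union> {\<gamma>\<in>\<Psi>. ?c \<gamma> \<noteq> ?c \<alpha>}"
    and dj: "{\<gamma>\<in>\<Psi>. ?c \<gamma> = ?c \<alpha>} \<inter> {\<gamma>\<in>\<Psi>. ?c \<gamma> \<noteq> ?c \<alpha>} = {}"
    by auto
  have irr: "irreducible_roots \<Psi>" using \<Psi> by (simp add: irreducible_component_def)
  have orth: "orthogonal x y" if "x \<in> {\<gamma>\<in>\<Psi>. ?c \<gamma> = ?c \<alpha>}" "y \<in> {\<gamma>\<in>\<Psi>. ?c \<gamma> \<noteq> ?c \<alpha>}" for x y
    using that norm_ratio_Aut_roots[OF \<Phi> f, of x y] sub by auto
  have "{\<gamma>\<in>\<Psi>. ?c \<gamma> = ?c \<alpha>} = {} \<or> {\<gamma>\<in>\<Psi>. ?c \<gamma> \<noteq> ?c \<alpha>} = {}"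
    by (rule irreducible_rootsD[OF irr un dj orth])
  moreover have "\<alpha> \<in> {\<gamma>\<in>\<Psi>. ?c \<gamma> = ?c \<alpha>}" "\<beta> \<in> {\<gamma>\<in>\<Psi>. ?c \<gamma> \<noteq> ?c \<alpha>}"
    using \<alpha> \<beta> ne[symmetric] by blast+
  ultimately show False by blast
qed

text \<open>One shortest root \<mu> of the component suffices, and f \<mu> is shortest in the image
  component. If the image is the same component, both norms are the minimum over one set. Otherwise
  there are two distinct components, which is exactly when the normalisation compares short
  roots.\<close>

lemma norm_Aut_roots:
  assumes \<Phi>: "root_system \<Phi>" and nrm: "normalized_roots \<Phi>" and f: "f \<in> Aut_roots \<Phi>"
    and \<alpha>: "\<alpha> \<in> \<Phi>"
  shows "norm (f \<alpha>) = norm \<alpha>"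
proof -
  note F = Aut_rootsD[OF f]
  define \<Psi> where "\<Psi> = (linked \<Phi>)\<^sup>* `` {\<alpha>}"
  have \<Psi>: "irreducible_component \<Phi> \<Psi>" and \<alpha>\<Psi>: "\<alpha> \<in> \<Psi>"
    using irreducible_component_linked_class[OF \<alpha>] by (auto simp: \<Psi>_def)
  have sub: "\<Psi> \<subseteq> \<Phi>" using \<Psi> by (auto simp: irreducible_component_def)
  then have fin: "finite \<Psi>" using root_systemD(1)[OF \<Phi>] finite_subset by blast
  have f\<Psi>: "irreducible_component \<Phi> (f ` \<Psi>)"
    by (rule irreducible_component_image[OF \<Phi> f \<Psi>])
  obtain \<mu> where \<mu>: "\<mu> \<in> \<Psi>" "\<And>\<beta>. \<beta> \<in> \<Psi> \<Longrightarrow> norm \<mu> \<le> norm \<beta>"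
    using fin \<alpha>\<Psi> by (metis arg_min_if_finite(1) arg_min_least empty_iff)
  have pos: "norm \<beta> > 0" "norm (f \<beta>) > 0" if "\<beta> \<in> \<Psi>" for \<beta>
    using that sub root_systemD(2)[OF \<Phi>] F(4) by (metis subsetD zero_less_norm_iff)+
  have c: "norm (f \<beta>) = (norm (f \<mu>) / norm \<mu>) * norm \<beta>" if "\<beta> \<in> \<Psi>" for \<beta>
    using norm_ratio_const[OF \<Phi> f \<Psi> that \<mu>(1)] pos[OF that] by (simp add: field_simps)
  have f\<mu>: "norm (f \<mu>) \<le> norm (f \<beta>)" if "\<beta> \<in> \<Psi>" for \<beta>
  proof -
    have "(norm (f \<mu>) / norm \<mu>) * norm \<mu> \<le> (norm (f \<mu>) / norm \<mu>) * norm \<beta>"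
      using \<mu>(2)[OF that] by (intro mult_left_mono) auto
    then show ?thesis using c[OF \<mu>(1)] c[OF that] by simp
  qed
  have short: "\<mu> \<in> short_roots \<Phi>" "f \<mu> \<in> short_roots \<Phi>"
    unfolding short_roots_def using \<Psi> f\<Psi> \<mu> f\<mu> by blast+
  have "norm (f \<mu>) = norm \<mu>"
  proof (cases "f ` \<Psi> = \<Psi>")
    case True
    then obtain \<beta> where "\<mu> = f \<beta>" "\<beta> \<in> \<Psi>" using \<mu>(1) by blast
    moreover have "f \<mu> \<in> \<Psi>" using True \<mu>(1) by blast
    ultimately show ?thesis using \<mu>(2) f\<mu> by (metis order_antisym)
  next
    case False
    then show ?thesis using nrm \<Psi> f\<Psi> short by (auto simp: normalized_roots_def)
  qed
  then show ?thesis using c[OF \<alpha>\<Psi>] pos[OF \<mu>(1)] by simp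
qed

theorem orthogonal_transformation_Aut_roots:
  assumes \<Phi>: "root_system \<Phi>" and nrm: "normalized_roots \<Phi>" and f: "f \<in> Aut_roots \<Phi>"
  shows "orthogonal_transformation f"
proof -
  note F = Aut_rootsD[OF f]
  have roots: "f \<alpha> \<bullet> f \<beta> = \<alpha> \<bullet> \<beta>" if "\<alpha> \<in> \<Phi>" "\<beta> \<in> \<Phi>" for \<alpha> \<beta>
  proof -
    have "\<beta> \<bullet> \<beta> \<noteq> 0" using that root_systemD(2)[OF \<Phi>] by auto
    moreover have "f \<beta> \<bullet> f \<beta> = \<beta> \<bullet> \<beta>"
      using norm_Aut_roots[OF \<Phi> nrm f that(2)] by (simp flip: power2_norm_eq_inner)
    ultimately show ?thesis
      using cartan_Aut_roots[OF \<Phi> f that(2,1)] by (simp add: cartan_def)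
  qed
  have sp: "x \<in> span \<Phi>" for x using root_systemD(3)[OF \<Phi>] by simp
  have root_left: "f \<alpha> \<bullet> f y = \<alpha> \<bullet> y" if "\<alpha> \<in> \<Phi>" for \<alpha> y
    using sp[of y]
    by (induction rule: span_induct_alt)
      (use F(1) roots that in \<open>simp_all add: linear_0 linear_add linear_scale inner_add_right\<close>)
  have "f x \<bullet> f y = x \<bullet> y" for x y
    using sp[of x]
    by (induction rule: span_induct_alt)
      (use F(1) root_left in \<open>simp_all add: linear_0 linear_add linear_scale inner_add_left\<close>)
  then show ?thesis using F(1) by (simp add: orthogonal_transformation_def)
qed

section \<open>Simple systems\<close>

locale based_root_system =
  fixes \<Phi> \<Delta> :: "'a::euclidean_space set"
  assumes roots: "root_system \<Phi>" and simple: "simple_roots \<Phi> \<Delta>"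
begin

abbreviation coeff :: "'a \<Rightarrow> 'a \<Rightarrow> real" where
  "coeff \<equiv> representation \<Delta>"

abbreviation pos :: "'a set" where
  "pos \<equiv> positive_roots \<Phi> \<Delta>"

abbreviation \<delta> :: 'a where
  "\<delta> \<equiv> delta \<Phi> \<Delta>"

lemmas root_facts = root_systemD[OF roots]

lemma simple_facts:
  shows "\<Delta> \<subseteq> \<Phi>" "independent \<Delta>" "span \<Delta> = UNIV" "finite \<Delta>"
proof -
  show *: "\<Delta> \<subseteq> \<Phi>" "independent \<Delta>" "span \<Delta> = UNIV"
    using simple by (auto simp: simple_roots_def)
  show "finite \<Delta>" using *(1) root_facts(1) by (rule finite_subset)
qed

lemma simple_nonzero: "\<alpha> \<in> \<Delta> \<Longrightarrow> \<alpha> \<noteq> 0"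
  using simple_facts(1) root_facts(2) by blast

lemma coeff_diff: "coeff (u - v) \<gamma> = coeff u \<gamma> - coeff v \<gamma>"
  and coeff_scale: "coeff (c *\<^sub>R v) \<gamma> = c * coeff v \<gamma>"
  and coeff_minus: "coeff (- v) \<gamma> = - coeff v \<gamma>"
  and coeff_sum: "coeff (sum f I) \<gamma> = (\<Sum>i\<in>I. coeff (f i) \<gamma>)"
  using simple_facts
  by (simp_all add: representation_diff representation_scale
      representation_neg representation_sum)

lemma coeff_simple: "\<alpha> \<in> \<Delta> \<Longrightarrow> coeff \<alpha> \<gamma> = (if \<gamma> = \<alpha> then 1 else 0)"
  using simple_facts by (simp add: representation_basis)

lemma coeff_expand: "v = (\<Sum>\<gamma>\<in>\<Delta>. coeff v \<gamma> *\<^sub>R \<gamma>)"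
  using simple_facts by (simp add: sum_representation_eq)

lemma inner_coeff: "x \<bullet> v = (\<Sum>\<gamma>\<in>\<Delta>. coeff v \<gamma> * (x \<bullet> \<gamma>))"
  by (subst coeff_expand[of v]) (simp add: inner_sum_right)

lemma coeff_cong: "(\<And>\<gamma>. \<gamma> \<in> \<Delta> \<Longrightarrow> coeff u \<gamma> = coeff v \<gamma>) \<Longrightarrow> u = v"
  by (subst coeff_expand[of u], subst coeff_expand[of v]) simp

lemma coeff_eq_0_span:
  assumes "v \<in> span S" "S \<subseteq> \<Delta>" "\<gamma> \<notin> S"
  shows "coeff v \<gamma> = 0"
  using assms simple_facts(2) by (metis representation_extend representation_ne_zero)

lemma span_iff_coeff:
  assumes "S \<subseteq> \<Delta>"
  shows "v \<in> span S \<longleftrightarrow> (\<forall>\<gamma>\<in>\<Delta> - S. coeff v \<gamma> = 0)"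
proof
  assume "\<forall>\<gamma>\<in>\<Delta> - S. coeff v \<gamma> = 0"
  then have "v = (\<Sum>\<gamma>\<in>S. coeff v \<gamma> *\<^sub>R \<gamma>)"
    using coeff_expand[of v] sum.mono_neutral_right[OF simple_facts(4) assms, of "\<lambda>\<gamma>. coeff v \<gamma> *\<^sub>R \<gamma>"]
    by simp
  moreover have "(\<Sum>\<gamma>\<in>S. coeff v \<gamma> *\<^sub>R \<gamma>) \<in> span S"
    by (intro span_sum span_scale span_base)
  ultimately show "v \<in> span S" by (rule ssubst)
qed (use assms coeff_eq_0_span in blast)

lemma simple_span_Int: "S \<subseteq> \<Delta> \<Longrightarrow> \<Delta> \<inter> span S = S"
  by (force simp: span_iff_coeff coeff_simple split: if_splits intro: span_base)

section \<open>Positive roots and simple reflections\<close>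

lemma pos_root: "\<beta> \<in> pos \<Longrightarrow> \<beta> \<in> \<Phi>"
  and pos_coeff: "\<beta> \<in> pos \<Longrightarrow> coeff \<beta> \<gamma> \<ge> 0"
  and pos_finite: "finite pos"
proof -
  show "\<beta> \<in> pos \<Longrightarrow> \<beta> \<in> \<Phi>" by (simp add: positive_roots_def)
  show "coeff \<beta> \<gamma> \<ge> 0" if "\<beta> \<in> pos"
    using that representation_ne_zero[of \<Delta> \<beta> \<gamma>]
    unfolding positive_roots_def by (metis (mono_tags, lifting) mem_Collect_eq order_refl)
  show "finite pos" using root_facts(1) by (simp add: positive_roots_def)
qed

lemma neg_coeff:
  assumes "\<beta> \<in> \<Phi>" "\<beta> \<notin> pos"
  shows "coeff \<beta> \<gamma> \<le> 0"
proof (cases "\<gamma> \<in> \<Delta>")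
  case True
  then show ?thesis using assms simple by (auto simp: positive_roots_def simple_roots_def)
next
  case False
  then show ?thesis using representation_ne_zero[of \<Delta> \<beta> \<gamma>] by fastforce
qed

lemma neg_root: "\<beta> \<in> \<Phi> \<Longrightarrow> \<beta> \<notin> pos \<Longrightarrow> - \<beta> \<in> pos"
  using neg_coeff root_facts(6) by (simp add: positive_roots_def coeff_minus)

lemma pos_if_coeff_pos: "\<beta> \<in> \<Phi> \<Longrightarrow> coeff \<beta> \<gamma> > 0 \<Longrightarrow> \<beta> \<in> pos"
  using neg_coeff by (meson not_le)

lemma simple_pos: "\<alpha> \<in> \<Delta> \<Longrightarrow> \<alpha> \<in> pos"
  using simple_facts(1) by (auto simp: positive_roots_def coeff_simple)

lemma pos_not_neg: "\<beta> \<in> pos \<Longrightarrow> - \<beta> \<notin> pos"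
proof
  assume *: "\<beta> \<in> pos" "- \<beta> \<in> pos"
  have "coeff \<beta> \<gamma> = 0" for \<gamma>
    using pos_coeff[OF *(1), of \<gamma>] pos_coeff[OF *(2), of \<gamma>] by (simp add: coeff_minus)
  then have "\<beta> = 0" using coeff_cong[of \<beta> 0] by (simp add: representation_zero)
  then show False using pos_root[OF *(1)] root_facts(2) by simp
qed

text \<open>Reducedness enters here: a root that is a multiple of \<alpha> is \<alpha> or -\<alpha>,
  and positivity leaves \<alpha>.\<close>

lemma pos_multiple_simple:
  assumes "\<alpha> \<in> \<Delta>" "\<beta> \<in> pos" "\<And>\<gamma>. \<gamma> \<in> \<Delta> - {\<alpha>} \<Longrightarrow> coeff \<beta> \<gamma> = 0"
  shows "\<beta> = \<alpha>"
proof -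
  have eq: "\<beta> = coeff \<beta> \<alpha> *\<^sub>R \<alpha>"
    by (rule coeff_cong) (use assms in \<open>auto simp: coeff_scale coeff_simple\<close>)
  moreover have "\<alpha> \<in> \<Phi>" using assms(1) simple_facts(1) by blast
  ultimately have "coeff \<beta> \<alpha> = 1 \<or> coeff \<beta> \<alpha> = -1"
    using root_facts(5) pos_root[OF assms(2)] by metis
  then have "coeff \<beta> \<alpha> = 1" using pos_coeff[OF assms(2), of \<alpha>] by linarith
  then show ?thesis using eq by simp
qed

text \<open>The reflection changes only the coefficient at \<alpha>. Some other coefficient of
  \<beta> is positive and stays so, and one positive coefficient makes a root positive.\<close>

lemma reflection_simple_pos:
  assumes "\<alpha> \<in> \<Delta>" "\<beta> \<in> pos" "\<beta> \<noteq> \<alpha>"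
  shows "reflection \<alpha> \<beta> \<in> pos"
proof -
  obtain \<gamma> where \<gamma>: "\<gamma> \<in> \<Delta>" "\<gamma> \<noteq> \<alpha>" "coeff \<beta> \<gamma> \<noteq> 0"
    using pos_multiple_simple assms by blast
  have "coeff (reflection \<alpha> \<beta>) \<gamma> = coeff \<beta> \<gamma>"
    using \<gamma> assms(1) by (simp add: reflection_def coeff_diff coeff_scale coeff_simple)
  then have "coeff (reflection \<alpha> \<beta>) \<gamma> > 0"
    using pos_coeff[OF assms(2), of \<gamma>] \<gamma>(3) by linarith
  moreover have "reflection \<alpha> \<beta> \<in> \<Phi>"
    using assms simple_facts(1) pos_root root_facts(4) by blast
  ultimately show ?thesis by (rule pos_if_coeff_pos[rotated])
qed

lemma delta_eq: "\<delta> = (1/2) *\<^sub>R (\<Sum>\<beta>\<in>pos. \<beta>)"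
  by (simp add: delta_def pi_sub_def)

text \<open>The reflection permutes the positive roots other than \<alpha> and negates \<alpha>, so
  the sum of all positive roots drops by twice \<alpha>.\<close>

lemma reflection_delta:
  assumes \<alpha>: "\<alpha> \<in> \<Delta>"
  shows "reflection \<alpha> \<delta> = \<delta> - \<alpha>"
proof -
  have ne: "reflection \<alpha> \<beta> \<noteq> \<alpha>" if "\<beta> \<in> pos" for \<beta>
    using that pos_not_neg simple_pos[OF \<alpha>] by (metis reflection_involution reflection_self)
  have "reflection \<alpha> ` (pos - {\<alpha>}) = pos - {\<alpha>}"
  proof
    show *: "reflection \<alpha> ` (pos - {\<alpha>}) \<subseteq> pos - {\<alpha>}"
      using reflection_simple_pos[OF \<alpha>] ne by (intro image_subsetI) auto
    show "pos - {\<alpha>} \<subseteq> reflection \<alpha> ` (pos - {\<alpha>})"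
    proof
      fix \<beta> assume "\<beta> \<in> pos - {\<alpha>}"
      then have "reflection \<alpha> \<beta> \<in> pos - {\<alpha>}" using * by blast
      then show "\<beta> \<in> reflection \<alpha> ` (pos - {\<alpha>})" by (metis reflection_involution imageI)
    qed
  qed
  moreover have "inj_on (reflection \<alpha>) (pos - {\<alpha>})"
    by (meson inj_on_def reflection_involution inj_on_inverseI)
  ultimately have perm: "(\<Sum>\<beta>\<in>pos - {\<alpha>}. reflection \<alpha> \<beta>) = (\<Sum>\<beta>\<in>pos - {\<alpha>}. \<beta>)"
    using sum.reindex[of "reflection \<alpha>" "pos - {\<alpha>}" "\<lambda>\<beta>. \<beta>"] by simp
  have split: "(\<Sum>\<beta>\<in>pos. f \<beta>) = f \<alpha> + (\<Sum>\<beta>\<in>pos - {\<alpha>}. f \<beta>)" for f :: "'a \<Rightarrow> 'a"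
    using simple_pos[OF \<alpha>] pos_finite by (simp add: sum.remove)
  have "reflection \<alpha> \<delta> = (1/2) *\<^sub>R (\<Sum>\<beta>\<in>pos. reflection \<alpha> \<beta>)"
    unfolding delta_eq using linear_reflection[of \<alpha>] by (simp add: linear_scale linear_sum)
  also have "\<dots> = (1/2) *\<^sub>R ((\<Sum>\<beta>\<in>pos. \<beta>) - 2 *\<^sub>R \<alpha>)"
    unfolding split[of "reflection \<alpha>"] perm split[of "\<lambda>\<beta>. \<beta>"] by (simp add: reflection_self scaleR_2)
  also have "\<dots> = \<delta> - \<alpha>" by (simp add: delta_eq scaleR_diff_right)
  finally show ?thesis .
qed

lemma delta_simple:
  assumes \<alpha>: "\<alpha> \<in> \<Delta>"
  shows "2 * (\<delta> \<bullet> \<alpha>) = \<alpha> \<bullet> \<alpha>" "\<delta> \<bullet> \<alpha> > 0"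
proof -
  have "(2 * (\<delta> \<bullet> \<alpha>) / (\<alpha> \<bullet> \<alpha>)) *\<^sub>R \<alpha> = 1 *\<^sub>R \<alpha>"
    using reflection_delta[OF \<alpha>] by (simp add: reflection_def)
  then have "2 * (\<delta> \<bullet> \<alpha>) / (\<alpha> \<bullet> \<alpha>) = 1"
    using simple_nonzero[OF \<alpha>] by (metis scaleR_right_imp_eq)
  then show *: "2 * (\<delta> \<bullet> \<alpha>) = \<alpha> \<bullet> \<alpha>" using simple_nonzero[OF \<alpha>] by simp
  have "\<alpha> \<bullet> \<alpha> > 0" using simple_nonzero[OF \<alpha>] by simp
  then show "\<delta> \<bullet> \<alpha> > 0" using * by linarith
qed

lemma pos_coeff_ex:
  assumes "\<beta> \<in> pos"
  obtains \<gamma> where "\<gamma> \<in> \<Delta>" "coeff \<beta> \<gamma> > 0"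
proof -
  have "\<beta> \<noteq> 0" using pos_root[OF assms] root_facts(2) by blast
  then obtain \<gamma> where "\<gamma> \<in> \<Delta>" "coeff \<beta> \<gamma> \<noteq> 0"
    using coeff_cong[of \<beta> 0] by (auto simp: representation_zero)
  then show thesis using that pos_coeff[OF assms, of \<gamma>] by force
qed

lemma inner_pos_if_simple:
  assumes v: "\<And>\<alpha>. \<alpha> \<in> \<Delta> \<Longrightarrow> v \<bullet> \<alpha> > 0" and \<beta>: "\<beta> \<in> pos"
  shows "v \<bullet> \<beta> > 0"
proof -
  obtain \<gamma> where \<gamma>: "\<gamma> \<in> \<Delta>" "coeff \<beta> \<gamma> > 0" by (rule pos_coeff_ex[OF \<beta>])
  have "0 < coeff \<beta> \<gamma> * (v \<bullet> \<gamma>)" using \<gamma> v by simp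
  also have "\<dots> \<le> (\<Sum>\<gamma>\<in>\<Delta>. coeff \<beta> \<gamma> * (v \<bullet> \<gamma>))"
    using \<gamma>(1) simple_facts(4) v pos_coeff[OF \<beta>]
    by (intro member_le_sum) (simp_all add: less_imp_le)
  finally show ?thesis by (simp add: inner_coeff[of v \<beta>])
qed

lemma delta_pos: "\<beta> \<in> pos \<Longrightarrow> \<delta> \<bullet> \<beta> > 0"
  by (rule inner_pos_if_simple[OF delta_simple(2)])

text \<open>The induction descends along \<open>\<delta> \<bullet> \<beta>\<close>: a non-simple positive root has positive inner product
  with some simple root, and reflecting in that root lowers it.\<close>

lemma pos_induct [consumes 1, case_names simple reflect]:
  assumes "\<beta> \<in> pos"
    and simple: "\<And>\<alpha>. \<alpha> \<in> \<Delta> \<Longrightarrow> P \<alpha>"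
    and reflect: "\<And>\<alpha> \<gamma>. \<alpha> \<in> \<Delta> \<Longrightarrow> \<gamma> \<in> pos \<Longrightarrow> P \<gamma> \<Longrightarrow> P (reflection \<alpha> \<gamma>)"
  shows "P \<beta>"
proof (rule ccontr)
  assume "\<not> P \<beta>"
  let ?S = "{\<beta> \<in> pos. \<not> P \<beta>}"
  have "finite ?S" "?S \<noteq> {}" using pos_finite assms(1) \<open>\<not> P \<beta>\<close> by auto
  then obtain \<mu> where \<mu>: "\<mu> \<in> ?S" "\<And>\<gamma>. \<gamma> \<in> ?S \<Longrightarrow> \<delta> \<bullet> \<mu> \<le> \<delta> \<bullet> \<gamma>"
    by (metis (no_types, lifting) arg_min_if_finite(1) arg_min_least)
  then have \<mu>pos: "\<mu> \<in> pos" by blast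
  have "\<exists>\<alpha>\<in>\<Delta>. \<mu> \<bullet> \<alpha> > 0"
  proof (rule ccontr)
    assume "\<not> ?thesis"
    then have "(\<Sum>\<gamma>\<in>\<Delta>. coeff \<mu> \<gamma> * (\<mu> \<bullet> \<gamma>)) \<le> 0"
      using pos_coeff[OF \<mu>pos] by (intro sum_nonpos mult_nonneg_nonpos) (auto simp: not_less)
    then have "\<mu> \<bullet> \<mu> \<le> 0" by (simp add: inner_coeff[of \<mu> \<mu>])
    then show False using pos_root[OF \<mu>pos] root_facts(2) by (metis inner_gt_zero_iff not_le)
  qed
  then obtain \<alpha> where \<alpha>: "\<alpha> \<in> \<Delta>" "\<mu> \<bullet> \<alpha> > 0" by blast
  have "\<mu> \<noteq> \<alpha>" using simple \<alpha>(1) \<mu>(1) by blast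
  then have \<nu>: "reflection \<alpha> \<mu> \<in> pos" by (rule reflection_simple_pos[OF \<alpha>(1) \<mu>pos])
  have "\<alpha> \<bullet> \<alpha> > 0" using simple_nonzero[OF \<alpha>(1)] by simp
  then have "\<delta> \<bullet> reflection \<alpha> \<mu> < \<delta> \<bullet> \<mu>"
    using \<alpha> delta_simple(2)[OF \<alpha>(1)] by (simp add: reflection_def inner_diff_right)
  then have "P (reflection \<alpha> \<mu>)" using \<mu>(2) \<nu> by force
  then have "P \<mu>" using reflect[OF \<alpha>(1) \<nu>] by (simp add: reflection_involution)
  then show False using \<mu>(1) by blast
qed

lemma root_conjugate_simple:
  assumes "\<beta> \<in> \<Phi>"
  shows "\<exists>w\<in>weyl_group \<Phi>. \<exists>\<alpha>\<in>\<Delta>. \<beta> = w \<alpha>"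
proof -
  have pos: "\<exists>w\<in>weyl_group \<Phi>. \<exists>\<alpha>\<in>\<Delta>. \<beta> = w \<alpha>" if "\<beta> \<in> pos" for \<beta>
    using that
  proof (induction rule: pos_induct)
    case (simple \<alpha>)
    then show ?case using weyl_group.weyl_id by (metis id_apply)
  next
    case (reflect \<alpha> \<gamma>)
    then show ?case using simple_facts(1) by (metis comp_apply subsetD weyl_group.weyl_step)
  qed
  show ?thesis
  proof (cases "\<beta> \<in> pos")
    case False
    then obtain w \<alpha> where w: "w \<in> weyl_group \<Phi>" "\<alpha> \<in> \<Delta>" "- \<beta> = w \<alpha>"
      using pos neg_root[OF assms] by blast
    have "reflection \<beta> (- \<beta>) = \<beta>"
      using linear_neg[OF linear_reflection, of \<beta> \<beta>] by (simp add: reflection_self)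
    then have "\<beta> = (reflection \<beta> \<circ> w) \<alpha>" by (simp flip: w(3))
    then show ?thesis using w assms by (meson weyl_group.weyl_step)
  qed (use pos in blast)
qed

text \<open>The simple root \<alpha> is the combination of the vectors k \<eta> with the
  coefficients of h \<alpha>. As \<alpha> spans an extremal ray of the cone of nonnegative
  combinations, every k \<eta> that occurs in it lies on that ray. The preimages \<open>k\<close>
  are left abstract so that they can be positive roots here and differences \<delta> - w \<delta>
  later.\<close>

lemma nonneg_inverse_ray:
  assumes h: "linear h" "inj h" and \<alpha>: "\<alpha> \<in> \<Delta>"
    and h\<alpha>: "\<And>\<gamma>. coeff (h \<alpha>) \<gamma> \<ge> 0"
    and k: "\<And>\<eta>. \<eta> \<in> \<Delta> \<Longrightarrow> h (k \<eta>) = \<eta>" "\<And>\<eta> \<zeta>. \<eta> \<in> \<Delta> \<Longrightarrow> coeff (k \<eta>) \<zeta> \<ge> 0"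
  obtains \<gamma> c where "\<gamma> \<in> \<Delta>" "k \<gamma> = c *\<^sub>R \<alpha>"
proof -
  have "h \<alpha> \<noteq> 0" using simple_nonzero[OF \<alpha>] h by (metis linear_0 injD)
  then obtain \<gamma> where \<gamma>: "\<gamma> \<in> \<Delta>" "coeff (h \<alpha>) \<gamma> \<noteq> 0"
    using coeff_cong[of "h \<alpha>" 0] by (auto simp: representation_zero)
  have "h (\<Sum>\<eta>\<in>\<Delta>. coeff (h \<alpha>) \<eta> *\<^sub>R k \<eta>) = (\<Sum>\<eta>\<in>\<Delta>. coeff (h \<alpha>) \<eta> *\<^sub>R \<eta>)"
    using h(1) k(1) by (simp add: linear_sum linear_scale)
  also have "\<dots> = h \<alpha>" by (rule coeff_expand[symmetric])
  finally have \<alpha>_eq: "(\<Sum>\<eta>\<in>\<Delta>. coeff (h \<alpha>) \<eta> *\<^sub>R k \<eta>) = \<alpha>" by (rule injD[OF h(2)])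
  have zero: "coeff (k \<gamma>) \<zeta> = 0" if \<zeta>: "\<zeta> \<noteq> \<alpha>" for \<zeta>
  proof -
    have "(\<Sum>\<eta>\<in>\<Delta>. coeff (h \<alpha>) \<eta> * coeff (k \<eta>) \<zeta>) = 0"
      using \<zeta> arg_cong[OF \<alpha>_eq, of "\<lambda>v. coeff v \<zeta>"] \<alpha>
      by (simp add: coeff_sum coeff_scale coeff_simple)
    moreover have "coeff (h \<alpha>) \<eta> * coeff (k \<eta>) \<zeta> \<ge> 0" if "\<eta> \<in> \<Delta>" for \<eta>
      using h\<alpha> k(2)[OF that] by simp
    ultimately have "coeff (h \<alpha>) \<gamma> * coeff (k \<gamma>) \<zeta> = 0"
      using \<gamma>(1) by (simp add: sum_nonneg_eq_0_iff[OF simple_facts(4)])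
    then show ?thesis using \<gamma>(2) by simp
  qed
  have "k \<gamma> = coeff (k \<gamma>) \<alpha> *\<^sub>R \<alpha>"
    by (rule coeff_cong) (use zero \<alpha> in \<open>simp add: coeff_scale coeff_simple\<close>)
  then show thesis using that \<gamma>(1) by blast
qed

lemma Aut_roots_pos_imp_simple:
  assumes h: "h \<in> Aut_roots \<Phi>" and hpos: "h ` pos = pos"
  shows "h ` \<Delta> = \<Delta>"
proof -
  note H = Aut_rootsD[OF h]
  have inj: "inj h" using H(2) by (rule bij_is_inj)
  have "h \<alpha> \<in> \<Delta>" if \<alpha>: "\<alpha> \<in> \<Delta>" for \<alpha>
  proof -
    have h\<alpha>: "h \<alpha> \<in> pos" using hpos simple_pos[OF \<alpha>] by blast
    have "\<exists>k\<in>pos. h k = \<eta>" if "\<eta> \<in> \<Delta>" for \<eta>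
      using simple_pos[OF that] hpos by (metis imageE)
    then obtain k where k: "\<And>\<eta>. \<eta> \<in> \<Delta> \<Longrightarrow> k \<eta> \<in> pos" "\<And>\<eta>. \<eta> \<in> \<Delta> \<Longrightarrow> h (k \<eta>) = \<eta>" by metis
    obtain \<gamma> c where \<gamma>: "\<gamma> \<in> \<Delta>" "k \<gamma> = c *\<^sub>R \<alpha>"
      by (rule nonneg_inverse_ray[OF H(1) inj \<alpha> pos_coeff[OF h\<alpha>] k(2) pos_coeff[OF k(1)]])
    have "k \<gamma> = \<alpha>"
      using \<alpha> k(1)[OF \<gamma>(1)] by (rule pos_multiple_simple) (use \<gamma>(2) \<alpha> in \<open>auto simp: coeff_scale coeff_simple\<close>)
    then show ?thesis using k(2)[OF \<gamma>(1)] \<gamma>(1) by simp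
  qed
  then have "h ` \<Delta> \<subseteq> \<Delta>" by blast
  moreover have "inj_on h \<Delta>" using inj by (rule inj_on_subset) simp
  ultimately show ?thesis using simple_facts(4) by (simp add: endo_inj_surj)
qed

text \<open>Automorphisms map \<delta> to half-sums over other subsets of \<Phi>. There are finitely
  many of these, so Weyl orbits of such vectors are finite without an appeal to the finiteness of
  W.\<close>

definition half_sum :: "'a set \<Rightarrow> 'a" where
  "half_sum T = (1/2) *\<^sub>R (\<Sum>\<beta>\<in>T. \<beta>)"

lemma half_sum_image:
  assumes "linear f" "inj f"
  shows "f (half_sum T) = half_sum (f ` T)"
  using assms
  by (simp add: half_sum_def linear_scale linear_sum sum.reindex inj_on_subset[OF assms(2)])

lemma delta_half_sum: "\<delta> = half_sum pos"
  by (simp add: half_sum_def delta_eq)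

lemma finite_weyl_orbit_half_sum:
  assumes "T \<subseteq> \<Phi>"
  shows "finite {w (half_sum T) | w. w \<in> weyl_group \<Phi>}"
proof (rule finite_subset)
  show "{w (half_sum T) | w. w \<in> weyl_group \<Phi>} \<subseteq> half_sum ` Pow \<Phi>"
  proof clarify
    fix w assume "w \<in> weyl_group \<Phi>"
    then have "w \<in> Aut_roots \<Phi>" by (rule weyl_group_Aut_roots[OF roots])
    note w = Aut_rootsD[OF this]
    have "w (half_sum T) = half_sum (w ` T)" using w by (intro half_sum_image bij_is_inj)
    moreover have "w ` T \<in> Pow \<Phi>" using w(3) assms by blast
    ultimately show "w (half_sum T) \<in> half_sum ` Pow \<Phi>" by blast
  qed
qed (use root_facts(1) in simp)

text \<open>The element of the Weyl group maximising \<open>w (f \<delta>) \<bullet> \<delta>\<close> moves the chamber of \<open>f \<delta>\<close> to the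
  fundamental one.\<close>

lemma Aut_roots_transitive:
  assumes f: "f \<in> Aut_roots \<Phi>" and orth: "orthogonal_transformation f"
  obtains w where "w \<in> weyl_group \<Phi>" "(w \<circ> f) ` pos = pos"
proof -
  note F = Aut_rootsD[OF f]
  define \<delta>' where "\<delta>' = f \<delta>"
  have \<delta>': "\<delta>' = half_sum (f ` pos)"
    unfolding \<delta>'_def delta_half_sum using F by (intro half_sum_image bij_is_inj)
  have "f ` pos \<subseteq> \<Phi>" using F(3) pos_root by blast
  then have fin: "finite {w \<delta>' | w. w \<in> weyl_group \<Phi>}"
    unfolding \<delta>' by (rule finite_weyl_orbit_half_sum)
  define M where "M = Max ((\<lambda>v. v \<bullet> \<delta>) ` {w \<delta>' | w. w \<in> weyl_group \<Phi>})"
  have "{w \<delta>' | w. w \<in> weyl_group \<Phi>} \<noteq> {}" using weyl_group.weyl_id by blast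
  then have "M \<in> (\<lambda>v. v \<bullet> \<delta>) ` {w \<delta>' | w. w \<in> weyl_group \<Phi>}"
    unfolding M_def using fin by (intro Max_in) auto
  then obtain w where w: "w \<in> weyl_group \<Phi>" "w \<delta>' \<bullet> \<delta> = M" by blast
  have max: "u \<delta>' \<bullet> \<delta> \<le> w \<delta>' \<bullet> \<delta>" if "u \<in> weyl_group \<Phi>" for u
    unfolding w(2) M_def using fin that by (intro Max_ge) auto
  define h where "h = w \<circ> f"
  have hA: "h \<in> Aut_roots \<Phi>"
    unfolding h_def using Aut_roots_comp[OF weyl_group_Aut_roots[OF roots w(1)] f] .
  note H = Aut_rootsD[OF hA]
  have horth: "orthogonal_transformation h"
    unfolding h_def
    by (rule orthogonal_transformation_compose[OF orthogonal_transformation_weyl[OF w(1)] orth])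
  have h\<delta>: "w \<delta>' = h \<delta>" by (simp add: h_def \<delta>'_def)
  have "h \<delta> \<bullet> \<alpha> > 0" if \<alpha>: "\<alpha> \<in> \<Delta>" for \<alpha>
  proof -
    have \<alpha>\<Phi>: "\<alpha> \<in> \<Phi>" using \<alpha> simple_facts(1) by blast
    \<comment> \<open>Maximality of \<open>w\<close> is tested against
      \<open>reflection \<alpha> \<circ> w\<close>; moving the reflection to the other factor
      replaces \<delta> by \<delta> - \<alpha>.\<close>
    have "reflection \<alpha> (h \<delta>) \<bullet> \<delta> \<le> h \<delta> \<bullet> \<delta>"
      using max[OF weyl_group.weyl_step[OF w(1) \<alpha>\<Phi>]] by (simp add: h\<delta>)
    then have "h \<delta> \<bullet> \<alpha> \<ge> 0"
      by (simp add: inner_reflection reflection_delta[OF \<alpha>] inner_diff_right)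
    \<comment> \<open>No root is orthogonal to \<delta>, and \<open>h\<close> is an isometry
      permuting the roots, so none is orthogonal to h \<delta>.\<close>
    moreover have "h \<delta> \<bullet> \<alpha> \<noteq> 0"
    proof -
      obtain \<beta> where \<beta>: "\<beta> \<in> \<Phi>" "\<alpha> = h \<beta>" using H(3) \<alpha>\<Phi> by blast
      have "\<delta> \<bullet> \<beta> \<noteq> 0"
        using delta_pos[of \<beta>] delta_pos[of "- \<beta>"] neg_root[OF \<beta>(1)] by fastforce
      then show ?thesis using \<beta>(2) orthogonal_transformation_inner[OF horth] by simp
    qed
    ultimately show ?thesis by simp
  qed
  then have *: "h \<delta> \<bullet> \<beta> > 0" if "\<beta> \<in> pos" for \<beta> using that by (rule inner_pos_if_simple)
  have sub: "h ` pos \<subseteq> pos"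
  proof clarify
    fix \<beta> assume \<beta>: "\<beta> \<in> pos"
    show "h \<beta> \<in> pos"
    proof (rule ccontr)
      assume "h \<beta> \<notin> pos"
      then have "h \<delta> \<bullet> - h \<beta> > 0" using * neg_root H(4) pos_root[OF \<beta>] by blast
      then show False
        using delta_pos[OF \<beta>] orthogonal_transformation_inner[OF horth] by simp
    qed
  qed
  have "inj_on h pos" using H(2) by (meson bij_is_inj inj_on_subset subset_UNIV)
  then have "h ` pos = pos" using sub pos_finite by (simp add: endo_inj_surj)
  then show thesis using that[OF w(1)] by (simp add: h_def)
qed

lemma coeff_weyl_delta_le:
  assumes "w \<in> Aut_roots \<Phi>"
  shows "coeff (w \<delta>) \<gamma> \<le> coeff \<delta> \<gamma>"
proof -
  note W = Aut_rootsD[OF assms]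
  have wd: "w \<delta> = half_sum (w ` pos)"
    unfolding delta_half_sum using W by (intro half_sum_image bij_is_inj)
  have fin: "finite (w ` pos)" using pos_finite by simp
  have "(\<Sum>\<beta>\<in>w ` pos. coeff \<beta> \<gamma>) = (\<Sum>\<beta>\<in>w ` pos \<inter> pos. coeff \<beta> \<gamma>) + (\<Sum>\<beta>\<in>w ` pos - pos. coeff \<beta> \<gamma>)"
    using fin by (rule sum.Int_Diff)
  also have "(\<Sum>\<beta>\<in>w ` pos - pos. coeff \<beta> \<gamma>) \<le> 0"
    using W(4) pos_root neg_coeff by (intro sum_nonpos) blast
  also have "(\<Sum>\<beta>\<in>w ` pos \<inter> pos. coeff \<beta> \<gamma>) \<le> (\<Sum>\<beta>\<in>pos. coeff \<beta> \<gamma>)"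
    using pos_finite pos_coeff by (intro sum_mono2) auto
  finally show ?thesis
    unfolding wd by (simp add: delta_half_sum half_sum_def coeff_scale coeff_sum)
qed

end

section \<open>Invariance of the permutonestohedron\<close>

context based_root_system
begin

text \<open>The stabiliser of the positive system. Its elements permute \<Delta> and so act as
  symmetries of the Dynkin diagram; orthogonality is included because the half-spaces are given by
  inner products.\<close>

definition diagram_auts :: "('a \<Rightarrow> 'a) set" where
  "diagram_auts = {h \<in> Aut_roots \<Phi>. orthogonal_transformation h \<and> h ` pos = pos}"

lemma diagram_autsD:
  assumes "h \<in> diagram_auts"
  shows "h \<in> Aut_roots \<Phi>" "orthogonal_transformation h" "h ` pos = pos" "h ` \<Delta> = \<Delta>"
    "linear h" "inj h" "surj h"
  using assms Aut_roots_pos_imp_simple[of h] Aut_rootsD[of h \<Phi>]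
  by (auto simp: diagram_auts_def bij_is_inj bij_is_surj)

lemma diagram_auts_inv:
  assumes "h \<in> diagram_auts"
  shows "inv_into UNIV h \<in> diagram_auts"
  using diagram_autsD[OF assms] Aut_roots_inv[of h \<Phi>] orthogonal_transformation_inv[of h]
  by (simp add: diagram_auts_def) (metis image_inv_f_f)

text \<open>Transitivity is applied to the inverse of \<open>f\<close>, which puts the diagram
  automorphism on the left. In this order w x satisfies the defining inequalities whenever x lies in
  the permutonestohedron, and \<open>h\<close> only permutes them.\<close>

lemma Aut_roots_decompose:
  assumes nrm: "normalized_roots \<Phi>" and f: "f \<in> Aut_roots \<Phi>"
  obtains h w where "h \<in> diagram_auts" "w \<in> weyl_group \<Phi>" "f = h \<circ> w"
proof -
  have orth: "orthogonal_transformation g" if "g \<in> Aut_roots \<Phi>" for g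
    by (rule orthogonal_transformation_Aut_roots[OF roots nrm that])
  have bf: "bij f" using f by (rule Aut_rootsD(2))
  have fi: "inv_into UNIV f \<in> Aut_roots \<Phi>" by (rule Aut_roots_inv[OF f])
  then obtain w where w: "w \<in> weyl_group \<Phi>" "(w \<circ> inv_into UNIV f) ` pos = pos"
    using Aut_roots_transitive[OF fi orth[OF fi]] by blast
  have bw: "bij w" using w(1) by (intro orthogonal_transformation_bij orthogonal_transformation_weyl)
  define h where "h = f \<circ> inv_into UNIV w"
  have "inv_into UNIV w ` pos = inv_into UNIV f ` pos"
    using w(2) bw by (metis bij_is_inj image_comp image_inv_f_f)
  then have "h ` pos = pos"
    unfolding h_def using bf by (metis bij_is_surj image_comp image_f_inv_f)
  moreover have "h \<in> Aut_roots \<Phi>"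
    unfolding h_def
    by (rule Aut_roots_comp[OF f weyl_group_Aut_roots[OF roots weyl_group_inv[OF w(1)]]])
  ultimately have "h \<in> diagram_auts" using orth by (simp add: diagram_auts_def)
  moreover have "f = h \<circ> w"
    using bw by (simp add: h_def fun_eq_iff bij_is_inj)
  ultimately show thesis using that w(1) by blast
qed

lemma diagram_pi_sub:
  assumes "h \<in> diagram_auts"
  shows "h (pi_sub \<Phi> \<Delta> A) = pi_sub \<Phi> \<Delta> (h ` A)"
proof -
  note H = diagram_autsD[OF assms]
  have "h ` (pos \<inter> A) = pos \<inter> h ` A" using H(3,6) by (simp add: image_Int)
  moreover have "pi_sub \<Phi> \<Delta> A = half_sum (pos \<inter> A)" for A
    by (simp add: pi_sub_def half_sum_def)
  ultimately show ?thesis using half_sum_image[OF H(5,6)] by metis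
qed

lemma diagram_delta:
  assumes "h \<in> diagram_auts"
  shows "h \<delta> = \<delta>"
  using diagram_pi_sub[OF assms, of UNIV] diagram_autsD(7)[OF assms] by (simp add: delta_def)

lemma diagram_C_fund:
  assumes "h \<in> diagram_auts" "C \<in> C_fund \<Delta>"
  shows "h ` C \<in> C_fund \<Delta>"
proof -
  note H = diagram_autsD[OF assms(1)]
  obtain S where S: "C = span S" "S \<noteq> {}" "S \<subseteq> \<Delta>" using assms(2) by (auto simp: C_fund_def)
  have "h ` C = span (h ` S)" using S H(5) by (simp add: linear_span_image)
  moreover have "h ` S \<noteq> {}" "h ` S \<subseteq> \<Delta>" using S H(4) by blast+
  ultimately show ?thesis unfolding C_fund_def by blast
qed

lemma diagram_G_fund:
  assumes "h \<in> diagram_auts" "invariant_under (Aut_roots \<Phi>) \<G>" "A \<in> G_fund \<Delta> \<G>"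
  shows "h ` A \<in> G_fund \<Delta> \<G>"
proof -
  note H = diagram_autsD[OF assms(1)]
  obtain S where S: "A = span S" "S \<subseteq> \<Delta>" "A \<in> \<G>" using assms(3) by (auto simp: G_fund_def)
  have "h ` A = span (h ` S)" using S H(5) by (simp add: linear_span_image)
  moreover have "h ` S \<subseteq> \<Delta>" using S H(4) by blast
  moreover have "h ` A \<in> \<G>" using assms(2) H(1) S(3) by (auto simp: invariant_under_def)
  ultimately show ?thesis unfolding G_fund_def by blast
qed

lemma diagram_max_elements:
  assumes h: "h \<in> diagram_auts" and inv: "invariant_under (Aut_roots \<Phi>) \<G>"
  shows "max_elements (G_fund \<Delta> \<G>) (h ` C) = (`) h ` max_elements (G_fund \<Delta> \<G>) C"
proof -
  let ?M = "max_elements (G_fund \<Delta> \<G>)"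
  \<comment> \<open>Stated for all diagram automorphisms and all C, so that the reverse inclusion is
    the instance at the inverse of \<open>h\<close>.\<close>
  have sub: "h ` A \<in> ?M (h ` C)" if h: "h \<in> diagram_auts" and A: "A \<in> ?M C" for h A C
  proof -
    note H = diagram_autsD[OF h]
    define k where "k = inv_into UNIV h"
    have k: "k \<in> diagram_auts" unfolding k_def by (rule diagram_auts_inv[OF h])
    have kh: "k ` h ` X = X" "h ` k ` X = X" for X
      using H(6,7) by (simp_all add: k_def image_inv_f_f image_f_inv_f)
    have "h ` A = B" if B: "B \<in> G_fund \<Delta> \<G>" "B \<subseteq> h ` C" "h ` A \<subseteq> B" for B
    proof -
      have "k ` B \<in> G_fund \<Delta> \<G>" by (rule diagram_G_fund[OF k inv B(1)])
      moreover have "k ` B \<subseteq> C" "A \<subseteq> k ` B"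
        using image_mono[OF B(2), of k] image_mono[OF B(3), of k] by (simp_all only: kh)
      ultimately have "A = k ` B" using A by (simp add: max_elements_def)
      then show ?thesis using kh by simp
    qed
    moreover have "h ` A \<in> G_fund \<Delta> \<G>" "h ` A \<subseteq> h ` C"
      using A diagram_G_fund[OF h inv] by (auto simp: max_elements_def)
    ultimately show ?thesis by (simp add: max_elements_def)
  qed
  have "A \<in> (`) h ` ?M C" if "A \<in> ?M (h ` C)" for A
  proof -
    note H = diagram_autsD[OF h]
    have "inv_into UNIV h ` A \<in> ?M C"
      using sub[OF diagram_auts_inv[OF h] that] H(6) by (simp add: image_inv_f_f)
    moreover have "A = h ` inv_into UNIV h ` A" using H(7) by (simp add: image_f_inv_f)
    ultimately show ?thesis by blast
  qed
  then show ?thesis using sub[OF h] by blast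
qed

lemma diagram_dim: "h \<in> diagram_auts \<Longrightarrow> dim (h ` A) = dim A"
  using diagram_autsD(5,6)[of h] dim_image_eq[of h A] inj_on_subset[of h UNIV "span A"] by simp

lemma diagram_HS:
  assumes h: "h \<in> diagram_auts" and x: "x \<in> HS \<Phi> \<Delta> \<epsilon> a A"
  shows "h x \<in> HS \<Phi> \<Delta> \<epsilon> a (h ` A)"
proof -
  note H = diagram_autsD[OF h]
  have "h ` A = UNIV \<longleftrightarrow> A = UNIV" using H(6,7) by (metis inj_image_eq_iff)
  moreover have "h x \<bullet> (\<delta> - pi_sub \<Phi> \<Delta> (h ` A)) = x \<bullet> (\<delta> - pi_sub \<Phi> \<Delta> A)"
    using diagram_delta[OF h] diagram_pi_sub[OF h] orthogonal_transformation_inner[OF H(2)]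
    by (metis inner_diff_right)
  moreover have "h x \<bullet> \<delta> = x \<bullet> \<delta>"
    using diagram_delta[OF h] orthogonal_transformation_inner[OF H(2)] by metis
  ultimately show ?thesis using x by (simp add: HS_def diagram_dim[OF h] split: if_splits)
qed

lemma diagram_HS_bar:
  assumes h: "h \<in> diagram_auts" and inv: "invariant_under (Aut_roots \<Phi>) \<G>"
    and x: "x \<in> HS_bar \<Phi> \<Delta> \<G> \<epsilon> a C"
  shows "h x \<in> HS_bar \<Phi> \<Delta> \<G> \<epsilon> a (h ` C)"
proof -
  note H = diagram_autsD[OF h]
  let ?M = "max_elements (G_fund \<Delta> \<G>)"
  have inj: "inj_on ((`) h) (?M C)" using H(6) by (auto simp: inj_on_def inj_image_eq_iff)
  have "(\<Sum>D\<in>?M (h ` C). \<epsilon> (dim D)) = (\<Sum>D\<in>?M C. \<epsilon> (dim D))"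
    unfolding diagram_max_elements[OF h inv] sum.reindex[OF inj]
    by (simp add: diagram_dim[OF h])
  moreover have "(\<Sum>D\<in>?M (h ` C). pi_sub \<Phi> \<Delta> D) = h (\<Sum>D\<in>?M C. pi_sub \<Phi> \<Delta> D)"
    unfolding diagram_max_elements[OF h inv] sum.reindex[OF inj]
    using H(5) by (simp add: linear_sum diagram_pi_sub[OF h])
  moreover have "h x \<bullet> (\<delta> - h v) = x \<bullet> (\<delta> - v)" for v
    using diagram_delta[OF h] orthogonal_transformation_inner[OF H(2)] by (metis inner_diff_right)
  ultimately show ?thesis using x by (simp add: HS_bar_def halfspace_origin_def split: if_splits)
qed

section \<open>Automorphisms acting on the permutonestohedron\<close>

lemma permutonestohedron_iff:
  "x \<in> permutonestohedron \<Phi> \<Delta> \<G> \<epsilon> a \<longleftrightarrow>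
    (\<forall>w\<in>weyl_group \<Phi>. (\<forall>A\<in>G_fund \<Delta> \<G>. w x \<in> HS \<Phi> \<Delta> \<epsilon> a A) \<and>
      (\<forall>C\<in>C_fund \<Delta> - G_fund \<Delta> \<G>. w x \<in> HS_bar \<Phi> \<Delta> \<G> \<epsilon> a C))" (is "_ \<longleftrightarrow> ?R")
proof -
  have bij: "bij w" if "w \<in> weyl_group \<Phi>" for w
    by (rule orthogonal_transformation_bij[OF orthogonal_transformation_weyl[OF that]])
  have mem: "x \<in> w ` X \<longleftrightarrow> inv_into UNIV w x \<in> X" if "w \<in> weyl_group \<Phi>" for w X
    using bij[OF that] by (metis bij_inv_eq_iff imageE image_eqI)
  have inv: "inv_into UNIV ` weyl_group \<Phi> = weyl_group \<Phi>"
  proof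
    show "weyl_group \<Phi> \<subseteq> inv_into UNIV ` weyl_group \<Phi>"
    proof
      fix w assume w: "w \<in> weyl_group \<Phi>"
      have "w = inv_into UNIV (inv_into UNIV w)" using bij[OF w] by (simp add: inv_inv_eq)
      then show "w \<in> inv_into UNIV ` weyl_group \<Phi>" using weyl_group_inv[OF w] by (rule image_eqI)
    qed
  qed (use weyl_group_inv in blast)
  have "x \<in> permutonestohedron \<Phi> \<Delta> \<G> \<epsilon> a \<longleftrightarrow>
    (\<forall>w\<in>weyl_group \<Phi>. (\<forall>A\<in>G_fund \<Delta> \<G>. x \<in> w ` HS \<Phi> \<Delta> \<epsilon> a A) \<and>
      (\<forall>C\<in>C_fund \<Delta> - G_fund \<Delta> \<G>. x \<in> w ` HS_bar \<Phi> \<Delta> \<G> \<epsilon> a C))"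
    unfolding permutonestohedron_def by blast
  also have "\<dots> \<longleftrightarrow> (\<forall>w\<in>inv_into UNIV ` weyl_group \<Phi>. (\<forall>A\<in>G_fund \<Delta> \<G>. w x \<in> HS \<Phi> \<Delta> \<epsilon> a A) \<and>
      (\<forall>C\<in>C_fund \<Delta> - G_fund \<Delta> \<G>. w x \<in> HS_bar \<Phi> \<Delta> \<G> \<epsilon> a C))"
    using mem by simp
  finally show ?thesis unfolding inv .
qed

text \<open>For u in W write u \<circ> f = h \<circ> w. The inequality indexed by A at h (w x) is
  the one indexed by the preimage of A under \<open>h\<close> at w x, and that is one of the
  inequalities assumed for x.\<close>

lemma Aut_roots_permutonestohedron:
  assumes nrm: "normalized_roots \<Phi>" and inv: "invariant_under (Aut_roots \<Phi>) \<G>"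
    and f: "f \<in> Aut_roots \<Phi>" and x: "x \<in> permutonestohedron \<Phi> \<Delta> \<G> \<epsilon> a"
  shows "f x \<in> permutonestohedron \<Phi> \<Delta> \<G> \<epsilon> a"
  unfolding permutonestohedron_iff
proof
  fix u assume "u \<in> weyl_group \<Phi>"
  then have "u \<circ> f \<in> Aut_roots \<Phi>" by (rule Aut_roots_comp[OF weyl_group_Aut_roots[OF roots] f])
  then obtain h w where h: "h \<in> diagram_auts" and w: "w \<in> weyl_group \<Phi>" and uf: "u \<circ> f = h \<circ> w"
    by (rule Aut_roots_decompose[OF nrm])
  have ufx: "u (f x) = h (w x)" using uf by (metis comp_apply)
  define k where "k = inv_into UNIV h"
  have k: "k \<in> diagram_auts" unfolding k_def by (rule diagram_auts_inv[OF h])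
  have kh: "k ` h ` X = X" "h ` k ` X = X" for X
    using diagram_autsD(6,7)[OF h] by (simp_all add: k_def image_inv_f_f image_f_inv_f)
  have "h (w x) \<in> HS \<Phi> \<Delta> \<epsilon> a A" if A: "A \<in> G_fund \<Delta> \<G>" for A
  proof -
    have "w x \<in> HS \<Phi> \<Delta> \<epsilon> a (k ` A)"
      using x w diagram_G_fund[OF k inv A] by (simp add: permutonestohedron_iff)
    from diagram_HS[OF h this] show ?thesis by (simp only: kh)
  qed
  moreover have "h (w x) \<in> HS_bar \<Phi> \<Delta> \<G> \<epsilon> a C" if C: "C \<in> C_fund \<Delta> - G_fund \<Delta> \<G>" for C
  proof -
    have "k ` C \<in> C_fund \<Delta> - G_fund \<Delta> \<G>"
      using C diagram_C_fund[OF k] diagram_G_fund[OF h inv, of "k ` C"] by (auto simp only: kh)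
    then have "w x \<in> HS_bar \<Phi> \<Delta> \<G> \<epsilon> a (k ` C)"
      using x w unfolding permutonestohedron_iff by blast
    from diagram_HS_bar[OF h inv this] show ?thesis by (simp only: kh)
  qed
  ultimately show "(\<forall>A\<in>G_fund \<Delta> \<G>. u (f x) \<in> HS \<Phi> \<Delta> \<epsilon> a A) \<and>
      (\<forall>C\<in>C_fund \<Delta> - G_fund \<Delta> \<G>. u (f x) \<in> HS_bar \<Phi> \<Delta> \<G> \<epsilon> a C)"
    unfolding ufx by blast
qed

lemma Aut_roots_subgroup:
  assumes nrm: "normalized_roots \<Phi>" and inv: "invariant_under (Aut_roots \<Phi>) \<G>"
  shows "subgroup (Aut_roots \<Phi>) (isometry_group (permutonestohedron \<Phi> \<Delta> \<G> \<epsilon> a))"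
    (is "subgroup _ (isometry_group ?P)")
proof -
  interpret group "isometry_group ?P" by (rule group_isometry_group)
  have sub: "f \<in> carrier (isometry_group ?P)" if f: "f \<in> Aut_roots \<Phi>" for f
  proof -
    have orth: "orthogonal_transformation f" by (rule orthogonal_transformation_Aut_roots[OF roots nrm f])
    have bij: "bij f" using f by (rule Aut_rootsD(2))
    note inv_f = Aut_roots_inv[OF f]
    have "f ` ?P = ?P"
    proof
      show "f ` ?P \<subseteq> ?P" using Aut_roots_permutonestohedron[OF nrm inv f] by blast
      show "?P \<subseteq> f ` ?P"
      proof
        fix x assume "x \<in> ?P"
        then have "inv_into UNIV f x \<in> ?P" by (rule Aut_roots_permutonestohedron[OF nrm inv inv_f])
        then show "x \<in> f ` ?P" using bij by (metis bij_inv_eq_iff imageI)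
      qed
    qed
    then show ?thesis
      using orth bij orthogonal_transformation_isometry[of f] by (auto simp: isometry_group_def)
  qed
  show ?thesis
  proof (rule subgroupI)
    show "Aut_roots \<Phi> \<subseteq> carrier (isometry_group ?P)" using sub by blast
    have "id \<in> Aut_roots \<Phi>" by (rule weyl_group_Aut_roots[OF roots weyl_group.weyl_id])
    then show "Aut_roots \<Phi> \<noteq> {}" by blast
  next
    fix f assume f: "f \<in> Aut_roots \<Phi>"
    have "inv_into UNIV f \<circ> f = id"
      using Aut_rootsD(2)[OF f] by (simp add: bij_is_inj)
    then have "m_inv (isometry_group ?P) f = inv_into UNIV f"
      using sub[OF f] sub[OF Aut_roots_inv[OF f]]
      by (intro inv_equality) (simp_all add: isometry_group_def)
    then show "m_inv (isometry_group ?P) f \<in> Aut_roots \<Phi>" using Aut_roots_inv[OF f] by simp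
  next
    fix f g assume "f \<in> Aut_roots \<Phi>" "g \<in> Aut_roots \<Phi>"
    then show "f \<otimes>\<^bsub>isometry_group ?P\<^esub> g \<in> Aut_roots \<Phi>"
      by (simp add: isometry_group_def Aut_roots_comp)
  qed
qed

end

section \<open>An interior point of the fundamental nestohedron\<close>

text \<open>The source of the chains with dimension rising by one. The roots \<alpha>, \<gamma> and
  the reflection \<beta> of \<gamma> satisfy a linear relation with nonzero coefficients, and each
  lies in a maximal element of \<G> inside C. Directness then forces \<alpha> into the summand that
  contains S, which must be all of C.\<close>

lemma building_set_extend:
  assumes \<Phi>: "root_system \<Phi>" and \<G>: "building_set \<Phi> \<G>" and S: "S \<subseteq> \<Phi>" "span S \<in> \<G>"
    and \<alpha>: "\<alpha> \<in> \<Phi>" and \<gamma>: "\<gamma> \<in> S" and no: "\<not> orthogonal \<alpha> \<gamma>"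
  shows "span (insert \<alpha> S) \<in> \<G>"
proof -
  note R = root_systemD[OF \<Phi>]
  define C where "C = span (insert \<alpha> S)"
  define U where "U = max_elements \<G> C"
  have \<gamma>\<Phi>: "\<gamma> \<in> \<Phi>" using S \<gamma> by blast
  have "C \<in> root_subspaces \<Phi>" using S(1) \<alpha> unfolding C_def root_subspaces_def by blast
  then have direct: "is_direct_sum C U" using \<G> unfolding building_set_def U_def by blast
  have "finite (root_subspaces \<Phi>)"
    by (rule finite_subset[of _ "span ` Pow \<Phi>"]) (use R(1) in \<open>auto simp: root_subspaces_def\<close>)
  then have fin: "finite \<G>" using \<G> finite_subset unfolding building_set_def by blast
  have above: "\<exists>M\<in>U. A \<subseteq> M" if A: "A \<in> \<G>" "A \<subseteq> C" for A
  proof -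
    have "finite {B\<in>\<G>. B \<subseteq> C \<and> A \<subseteq> B}" using fin by simp
    moreover have "A \<in> {B\<in>\<G>. B \<subseteq> C \<and> A \<subseteq> B}" using A by simp
    ultimately obtain M where M: "M \<in> {B\<in>\<G>. B \<subseteq> C \<and> A \<subseteq> B}"
      "\<forall>B\<in>{B\<in>\<G>. B \<subseteq> C \<and> A \<subseteq> B}. M \<subseteq> B \<longrightarrow> M = B"
      using finite_has_maximal2 by meson
    then have "M \<in> U" unfolding U_def max_elements_def by blast
    then show ?thesis using M(1) by blast
  qed
  have line: "\<exists>M\<in>U. \<beta> \<in> M" if \<beta>: "\<beta> \<in> \<Phi>" "\<beta> \<in> C" for \<beta>
  proof -
    have "span {\<beta>} \<in> \<G>" using \<beta>(1) \<G> by (auto simp: building_set_def)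
    moreover have "span {\<beta>} \<subseteq> C" using \<beta>(2) unfolding C_def by (simp add: span_minimal)
    ultimately obtain M where "M \<in> U" "span {\<beta>} \<subseteq> M" using above by blast
    then show ?thesis using span_base[of \<beta> "{\<beta>}"] by blast
  qed
  have indep: "x = 0" if "M \<in> U" "x \<in> M" "x \<in> span (\<Union>(U - {M}))" for x M
    using direct that unfolding is_direct_sum_def by blast
  define \<beta> where "\<beta> = reflection \<alpha> \<gamma>"
  define k where "k = 2 * (\<gamma> \<bullet> \<alpha>) / (\<alpha> \<bullet> \<alpha>)"
  have nz: "\<alpha> \<noteq> 0" "\<gamma> \<noteq> 0" "\<beta> \<noteq> 0" and \<beta>\<Phi>: "\<beta> \<in> \<Phi>"
    using R(2,4) \<alpha> \<gamma>\<Phi> unfolding \<beta>_def by metis+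
  have k: "k \<noteq> 0" using no nz by (simp add: k_def orthogonal_def inner_commute)
  have \<beta>: "\<beta> = \<gamma> - k *\<^sub>R \<alpha>" by (simp add: \<beta>_def k_def reflection_def)
  have C: "\<alpha> \<in> C" "\<gamma> \<in> C" unfolding C_def using \<gamma> by (auto intro: span_base)
  then have "\<beta> \<in> C" unfolding \<beta> C_def by (intro span_diff span_scale)
  then obtain M3 where M3: "M3 \<in> U" "\<beta> \<in> M3" using line \<beta>\<Phi> by blast
  obtain M2 where M2: "M2 \<in> U" "\<alpha> \<in> M2" using line \<alpha> C by blast
  have "span S \<subseteq> C" unfolding C_def by (intro span_mono) blast
  then obtain M1 where M1: "M1 \<in> U" "span S \<subseteq> M1" using above S(2) by blast
  have \<gamma>M1: "\<gamma> \<in> M1" using M1(2) \<gamma> span_base by blast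
  have "M1 = M2"
  proof (rule ccontr)
    assume ne: "M1 \<noteq> M2"
    \<comment> \<open>Wherever \<beta> lies, one root is a combination of vectors from other
      summands: \<beta> in the first case, \<alpha> in the second, \<gamma> in the third.\<close>
    consider "M3 \<noteq> M1" "M3 \<noteq> M2" | "M3 = M1" | "M3 = M2" by blast
    then show False
    proof cases
      case 1
      then have "\<gamma> \<in> span (\<Union>(U - {M3}))" "\<alpha> \<in> span (\<Union>(U - {M3}))"
        using M1(1) M2 \<gamma>M1 by (blast intro: span_base)+
      then have "\<beta> \<in> span (\<Union>(U - {M3}))" unfolding \<beta> by (intro span_diff span_scale)
      then show False using indep[OF M3] nz by blast
    next
      case 2
      then have "\<gamma> \<in> span (\<Union>(U - {M2}))" "\<beta> \<in> span (\<Union>(U - {M2}))"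
        using M1(1) M3 \<gamma>M1 ne by (blast intro: span_base)+
      then have "(1/k) *\<^sub>R (\<gamma> - \<beta>) \<in> span (\<Union>(U - {M2}))" by (intro span_diff span_scale)
      moreover have "(1/k) *\<^sub>R (\<gamma> - \<beta>) = \<alpha>" using k by (simp add: \<beta>)
      ultimately show False using indep[OF M2] nz by simp
    next
      case 3
      then have "\<alpha> \<in> span (\<Union>(U - {M1}))" "\<beta> \<in> span (\<Union>(U - {M1}))"
        using M2 M3 ne by (blast intro: span_base)+
      then have "\<beta> + k *\<^sub>R \<alpha> \<in> span (\<Union>(U - {M1}))" by (intro span_add span_scale)
      then show False using indep[OF M1(1) \<gamma>M1] nz by (simp add: \<beta>)
    qed
  qed
  have MG: "M1 \<in> \<G>" "M1 \<subseteq> C" using M1(1) by (auto simp: U_def max_elements_def)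
  have "subspace M1" using MG(1) \<G> unfolding building_set_def root_subspaces_def by auto
  moreover have "insert \<alpha> S \<subseteq> M1" using M1(2) M2(2) \<open>M1 = M2\<close> span_superset by blast
  ultimately have "C \<subseteq> M1" unfolding C_def by (simp add: span_minimal)
  then show ?thesis using MG by (simp add: C_def)
qed

context based_root_system
begin

section \<open>Coefficients of half-sums and weights on components\<close>

lemma coeff_pi_sub: "coeff (pi_sub \<Phi> \<Delta> A) \<gamma> = (1/2) * (\<Sum>\<beta>\<in>pos \<inter> A. coeff \<beta> \<gamma>)"
  by (simp add: pi_sub_def coeff_scale coeff_sum)

lemma coeff_pi_sub_nonneg: "coeff (pi_sub \<Phi> \<Delta> A) \<gamma> \<ge> 0"
  unfolding coeff_pi_sub by (intro mult_nonneg_nonneg sum_nonneg) (auto intro: pos_coeff)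

lemma coeff_pi_sub_mono: "A \<subseteq> B \<Longrightarrow> coeff (pi_sub \<Phi> \<Delta> A) \<gamma> \<le> coeff (pi_sub \<Phi> \<Delta> B) \<gamma>"
  unfolding coeff_pi_sub using pos_coeff pos_finite
  by (intro mult_left_mono sum_mono2) auto

lemma coeff_pi_sub_pos:
  assumes "\<gamma> \<in> \<Delta>" "\<gamma> \<in> A"
  shows "coeff (pi_sub \<Phi> \<Delta> A) \<gamma> > 0"
proof -
  have "coeff \<gamma> \<gamma> \<le> (\<Sum>\<beta>\<in>pos \<inter> A. coeff \<beta> \<gamma>)"
    using assms simple_pos pos_finite pos_coeff by (intro member_le_sum) auto
  then show ?thesis using assms by (simp add: coeff_pi_sub coeff_simple)
qed

lemma coeff_pi_sub_zero:
  assumes "S \<subseteq> \<Delta>" "\<gamma> \<notin> S"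
  shows "coeff (pi_sub \<Phi> \<Delta> (span S)) \<gamma> = 0"
  unfolding coeff_pi_sub using coeff_eq_0_span[OF _ assms] by simp

text \<open>For T equal to S or to its complement, a simple root either belongs to T or is
  orthogonal to T, so its reflection preserves span T. Induction over positive roots carries the
  alternative along.\<close>

lemma pos_split:
  assumes S: "S \<subseteq> \<Delta>" and orth: "\<And>\<alpha> \<gamma>. \<alpha> \<in> \<Delta> - S \<Longrightarrow> \<gamma> \<in> S \<Longrightarrow> orthogonal \<alpha> \<gamma>"
    and \<beta>: "\<beta> \<in> pos"
  shows "\<beta> \<in> span S \<or> \<beta> \<in> span (\<Delta> - S)"
  using \<beta>
proof (induction rule: pos_induct)
  case (simple \<alpha>)
  then show ?case by (blast intro: span_base)
next
  case (reflect \<alpha> \<gamma>)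
  have closed: "reflection \<alpha> \<gamma> \<in> span T"
    if "\<gamma> \<in> span T" "\<alpha> \<in> T \<or> (\<forall>\<eta>\<in>T. orthogonal \<alpha> \<eta>)" for T
    using that(2)
  proof
    assume "\<alpha> \<in> T"
    then show ?thesis
      unfolding reflection_def by (intro span_diff[OF that(1)] span_scale span_base)
  next
    assume "\<forall>\<eta>\<in>T. orthogonal \<alpha> \<eta>"
    then have "orthogonal \<alpha> \<gamma>" using that(1) orthogonal_to_span by blast
    then show ?thesis using that(1) by (simp add: reflection_def orthogonal_def inner_commute)
  qed
  have "\<alpha> \<in> S \<or> (\<forall>\<eta>\<in>S. orthogonal \<alpha> \<eta>)" using orth reflect(1) by blast
  moreover have "\<alpha> \<in> \<Delta> - S \<or> (\<forall>\<eta>\<in>\<Delta> - S. orthogonal \<alpha> \<eta>)"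
    using orth reflect(1) by (metis DiffI orthogonal_commute)
  ultimately show ?case using closed reflect(3) by blast
qed

lemma coeff_pi_sub_split:
  assumes S: "S \<subseteq> \<Delta>" and orth: "\<And>\<alpha> \<gamma>. \<alpha> \<in> \<Delta> - S \<Longrightarrow> \<gamma> \<in> S \<Longrightarrow> orthogonal \<alpha> \<gamma>"
    and \<gamma>: "\<gamma> \<in> S"
  shows "coeff (pi_sub \<Phi> \<Delta> (span S)) \<gamma> = coeff \<delta> \<gamma>"
proof -
  have "(\<Sum>\<beta>\<in>pos \<inter> span S. coeff \<beta> \<gamma>) = (\<Sum>\<beta>\<in>pos. coeff \<beta> \<gamma>)"
  proof (rule sum.mono_neutral_left[OF pos_finite])
    show "\<forall>\<beta>\<in>pos - pos \<inter> span S. coeff \<beta> \<gamma> = 0"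
    proof
      fix \<beta> assume "\<beta> \<in> pos - pos \<inter> span S"
      then have "\<beta> \<in> span (\<Delta> - S)" using pos_split[OF S orth] by blast
      then show "coeff \<beta> \<gamma> = 0" using \<gamma> by (intro coeff_eq_0_span) auto
    qed
  qed blast
  then show ?thesis by (simp add: delta_def coeff_pi_sub)
qed

text \<open>Constant on each connected class of simple roots, and scaled so that the products with
  the coefficients of \<delta> add up over a class to c times its size.\<close>

definition weight :: "real \<Rightarrow> 'a \<Rightarrow> real" where
  "weight c \<gamma> = c * real (card ((linked \<Delta>)\<^sup>* `` {\<gamma>})) / (\<Sum>\<eta>\<in>(linked \<Delta>)\<^sup>* `` {\<gamma>}. coeff \<delta> \<eta>)"

lemma linked_class_eq:
  assumes "(\<gamma>, \<eta>) \<in> (linked \<Delta>)\<^sup>*"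
  shows "(linked \<Delta>)\<^sup>* `` {\<gamma>} = (linked \<Delta>)\<^sup>* `` {\<eta>}"
proof -
  have "(\<eta>, \<gamma>) \<in> (linked \<Delta>)\<^sup>*" using assms sym_rtrancl[OF sym_linked] by (rule symD[rotated])
  then show ?thesis using assms by (auto intro: rtrancl_trans)
qed

lemma weight_linked: "\<gamma> \<in> \<Delta> \<Longrightarrow> \<eta> \<in> \<Delta> \<Longrightarrow> \<not> orthogonal \<gamma> \<eta> \<Longrightarrow> weight c \<gamma> = weight c \<eta>"
  using linked_class_eq[of \<gamma> \<eta>] by (simp add: weight_def linked_def r_into_rtrancl)

lemma delta_class_pos:
  assumes "\<gamma> \<in> \<Delta>"
  shows "(\<Sum>\<eta>\<in>(linked \<Delta>)\<^sup>* `` {\<gamma>}. coeff \<delta> \<eta>) > 0"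
proof -
  have sub: "(linked \<Delta>)\<^sup>* `` {\<gamma>} \<subseteq> \<Delta>" by (rule linked_class_subset[OF assms])
  show ?thesis
  proof (rule sum_pos)
    show "finite ((linked \<Delta>)\<^sup>* `` {\<gamma>})" using sub simple_facts(4) by (rule finite_subset)
    show "0 < coeff \<delta> \<eta>" if "\<eta> \<in> (linked \<Delta>)\<^sup>* `` {\<gamma>}" for \<eta>
      using that sub coeff_pi_sub_pos[of \<eta> UNIV] by (auto simp: delta_def)
  qed blast
qed

lemma weight_nonneg: "c \<ge> 0 \<Longrightarrow> \<gamma> \<in> \<Delta> \<Longrightarrow> weight c \<gamma> \<ge> 0"
  using delta_class_pos[of \<gamma>] by (simp add: weight_def)

text \<open>Here S is a union of classes. Rather than summing class by class, the cardinality in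
  \<open>weight\<close> is spread out as a sum over the class; class membership is symmetric, so
  after exchanging the sums each element of S contributes exactly c.\<close>

lemma sum_weight_split:
  assumes S: "S \<subseteq> \<Delta>" and orth: "\<And>\<alpha> \<gamma>. \<alpha> \<in> \<Delta> - S \<Longrightarrow> \<gamma> \<in> S \<Longrightarrow> orthogonal \<alpha> \<gamma>"
  shows "(\<Sum>\<gamma>\<in>S. coeff \<delta> \<gamma> * weight c \<gamma>) = c * real (card S)"
proof -
  let ?K = "\<lambda>\<gamma>. (linked \<Delta>)\<^sup>* `` {\<gamma>}"
  let ?s = "\<lambda>\<gamma>. \<Sum>\<eta>\<in>?K \<gamma>. coeff \<delta> \<eta>"
  have finS: "finite S" using S simple_facts(4) by (rule finite_subset)
  have K: "?K \<gamma> \<subseteq> S" if "\<gamma> \<in> S" for \<gamma>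
  proof -
    have "\<eta> \<in> S" if "(\<gamma>, \<eta>) \<in> (linked \<Delta>)\<^sup>*" for \<eta>
      using that
    proof induction
      case (step y z)
      then show ?case using orth[of z y] by (auto simp: linked_def orthogonal_commute)
    qed (fact \<open>\<gamma> \<in> S\<close>)
    then show ?thesis by blast
  qed
  have sym: "\<eta> \<in> ?K \<gamma> \<longleftrightarrow> \<gamma> \<in> ?K \<eta>" for \<gamma> \<eta>
    using sym_rtrancl[OF sym_linked[of \<Delta>]] by (auto dest: symD)
  have class_sum: "(\<Sum>\<eta>\<in>?K \<gamma>. F \<eta>) = (\<Sum>\<eta>\<in>S. if \<eta> \<in> ?K \<gamma> then F \<eta> else 0)"
    if "\<gamma> \<in> S" for \<gamma> and F :: "'a \<Rightarrow> real"
  proof -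
    have "{\<eta> \<in> S. \<eta> \<in> ?K \<gamma>} = ?K \<gamma>" using K[OF that] by blast
    then show ?thesis using sum.inter_filter[OF finS, of F "\<lambda>\<eta>. \<eta> \<in> ?K \<gamma>"] by simp
  qed
  have "(\<Sum>\<gamma>\<in>S. coeff \<delta> \<gamma> * weight c \<gamma>) = (\<Sum>\<gamma>\<in>S. \<Sum>\<eta>\<in>?K \<gamma>. c * coeff \<delta> \<gamma> / ?s \<gamma>)"
    by (simp add: weight_def ac_simps)
  also have "\<dots> = (\<Sum>\<gamma>\<in>S. \<Sum>\<eta>\<in>S. if \<eta> \<in> ?K \<gamma> then c * coeff \<delta> \<gamma> / ?s \<gamma> else 0)"
    by (rule sum.cong[OF refl class_sum])
  also have "\<dots> = (\<Sum>\<eta>\<in>S. \<Sum>\<gamma>\<in>S. if \<eta> \<in> ?K \<gamma> then c * coeff \<delta> \<gamma> / ?s \<gamma> else 0)"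
    by (rule sum.swap)
  also have "\<dots> = (\<Sum>\<eta>\<in>S. \<Sum>\<gamma>\<in>S. if \<gamma> \<in> ?K \<eta> then c * coeff \<delta> \<gamma> / ?s \<eta> else 0)"
  proof (intro sum.cong refl)
    fix \<eta> \<gamma>
    show "(if \<eta> \<in> ?K \<gamma> then c * coeff \<delta> \<gamma> / ?s \<gamma> else 0) =
        (if \<gamma> \<in> ?K \<eta> then c * coeff \<delta> \<gamma> / ?s \<eta> else 0)"
      using sym[of \<eta> \<gamma>] linked_class_eq[of \<gamma> \<eta>] by simp
  qed
  also have "\<dots> = (\<Sum>\<eta>\<in>S. \<Sum>\<gamma>\<in>?K \<eta>. c * coeff \<delta> \<gamma> / ?s \<eta>)"
    by (rule sum.cong[OF refl class_sum[symmetric]])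
  also have "\<dots> = (\<Sum>\<eta>\<in>S. c)"
  proof (intro sum.cong refl)
    fix \<eta> assume "\<eta> \<in> S"
    then have "?s \<eta> > 0" using delta_class_pos S by blast
    then show "(\<Sum>\<gamma>\<in>?K \<eta>. c * coeff \<delta> \<gamma> / ?s \<eta>) = c"
      by (simp flip: sum_divide_distrib sum_distrib_left)
  qed
  finally show ?thesis by simp
qed

text \<open>Extend \<open>f\<close> from the basis to a linear functional; its adjoint, applied to
  1, gives the vector.\<close>

lemma exists_simple_values: "\<exists>x. \<forall>\<gamma>\<in>\<Delta>. x \<bullet> \<gamma> = f \<gamma>"
proof -
  obtain g :: "'a \<Rightarrow> real" where g: "linear g" "\<forall>\<gamma>\<in>\<Delta>. g \<gamma> = f \<gamma>"
    using linear_independent_extend[OF simple_facts(2)] by blast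
  then show ?thesis using adjoint_works[OF g(1), of _ 1] by (metis inner_real_def mult_1 inner_commute)
qed

end

section \<open>Ratios and the growth of a suitable list\<close>

locale suitable_system = based_root_system +
  fixes \<G> :: "'a set set" and \<epsilon> :: "nat \<Rightarrow> real" and a :: real
  assumes building: "building_set \<Phi> \<G>"
    and suitable: "suitable_list \<Phi> \<Delta> \<G> \<epsilon> a"
begin

lemma G_fundE:
  assumes "A \<in> G_fund \<Delta> \<G>"
  obtains S where "S \<subseteq> \<Delta>" "S \<noteq> {}" "A = span S" "\<Delta> \<inter> A = S" "dim A = card S" "A \<in> \<G>"
proof -
  obtain S where S: "S \<subseteq> \<Delta>" "A = span S" "A \<in> \<G>" using assms by (auto simp: G_fund_def)
  have "A \<in> root_subspaces \<Phi>" using S(3) building by (auto simp: building_set_def)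
  then obtain T where T: "T \<noteq> {}" "T \<subseteq> \<Phi>" "A = span T" by (auto simp: root_subspaces_def)
  then obtain \<beta> where "\<beta> \<in> A" "\<beta> \<noteq> 0" using root_facts(2) span_base by blast
  then have "S \<noteq> {}" using S(2) by auto
  moreover have "dim A = card S"
    using S simple_facts(2) by (metis dim_span dim_eq_card_independent independent_mono)
  ultimately show thesis using that S simple_span_Int[OF S(1)] by metis
qed

lemma finite_G_fund: "finite (G_fund \<Delta> \<G>)"
  by (rule finite_subset[of _ "span ` Pow \<Delta>"]) (use simple_facts(4) in \<open>auto simp: G_fund_def\<close>)

lemma finite_ratios: "finite (ratios \<Phi> \<Delta> \<G> i j)"
  by (rule finite_subset[of _ "(\<lambda>(A, B). ratio \<Phi> \<Delta> A B) ` (G_fund \<Delta> \<G> \<times> G_fund \<Delta> \<G>)"])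
    (use finite_G_fund in \<open>auto simp: ratios_def\<close>)

text \<open>With p and q the extremal coefficients, p = (p / q) q. The indices \<eta> and \<gamma>
  are independent, which later allows a newly added simple root to be compared with one already in
  B.\<close>

lemma coeff_le_ratio:
  assumes B: "B \<in> G_fund \<Delta> \<G>" and \<eta>: "\<eta> \<in> \<Delta>" and \<gamma>: "\<gamma> \<in> \<Delta> \<inter> B"
  shows "coeff (pi_sub \<Phi> \<Delta> A) \<eta> \<le> ratio \<Phi> \<Delta> A B * coeff (pi_sub \<Phi> \<Delta> B) \<gamma>"
proof -
  define p where "p = Max (coeff (pi_sub \<Phi> \<Delta> A) ` \<Delta>)"
  define q where "q = Min (coeff (pi_sub \<Phi> \<Delta> B) ` (\<Delta> \<inter> B))"
  have fin: "finite \<Delta>" by (rule simple_facts(4))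
  have p: "coeff (pi_sub \<Phi> \<Delta> A) \<eta> \<le> p" unfolding p_def using fin \<eta> by simp
  have q: "q \<le> coeff (pi_sub \<Phi> \<Delta> B) \<gamma>" unfolding q_def using fin \<gamma> by simp
  have "q \<in> coeff (pi_sub \<Phi> \<Delta> B) ` (\<Delta> \<inter> B)" unfolding q_def using fin \<gamma> by (intro Min_in) auto
  then have q0: "q > 0" using coeff_pi_sub_pos by auto
  have "p \<ge> 0" using p coeff_pi_sub_nonneg[of A \<eta>] by linarith
  then have "p * q \<le> p * coeff (pi_sub \<Phi> \<Delta> B) \<gamma>" using q by (intro mult_left_mono)
  then have "p \<le> p / q * coeff (pi_sub \<Phi> \<Delta> B) \<gamma>" using q0 by (simp add: field_simps)
  then show ?thesis using p by (simp add: ratio_def p_def q_def)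
qed

lemma ratio_ge_1:
  assumes "A \<in> G_fund \<Delta> \<G>" "B \<in> G_fund \<Delta> \<G>" "B \<subseteq> A"
  shows "ratio \<Phi> \<Delta> A B \<ge> 1"
proof -
  obtain S where "S \<noteq> {}" "\<Delta> \<inter> B = S" using G_fundE[OF assms(2)] by metis
  then obtain \<gamma> where \<gamma>: "\<gamma> \<in> \<Delta> \<inter> B" by blast
  have "1 * coeff (pi_sub \<Phi> \<Delta> B) \<gamma> \<le> ratio \<Phi> \<Delta> A B * coeff (pi_sub \<Phi> \<Delta> B) \<gamma>"
    using coeff_pi_sub_mono[OF assms(3), of \<gamma>] coeff_le_ratio[OF assms(2) _ \<gamma>, of \<gamma> A] \<gamma> by simp
  then show ?thesis using coeff_pi_sub_pos[of \<gamma> B] \<gamma> by (simp add: mult_le_cancel_right)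
qed

lemma ratio_le_max_ratio:
  assumes "A \<in> G_fund \<Delta> \<G>" "B \<in> G_fund \<Delta> \<G>" "B \<subset> A"
  shows "ratio \<Phi> \<Delta> A B \<le> max_ratio \<Phi> \<Delta> \<G> (dim A) (dim B)"
proof -
  have "ratio \<Phi> \<Delta> A B \<in> ratios \<Phi> \<Delta> \<G> (dim A) (dim B)" using assms unfolding ratios_def by blast
  then show ?thesis unfolding max_ratio_def using Max_ge[OF finite_ratios] by auto
qed

lemma max_ratio_ge_1: "max_ratio \<Phi> \<Delta> \<G> i j \<ge> 1"
proof (cases "ratios \<Phi> \<Delta> \<G> i j = {}")
  case False
  then have "Max (ratios \<Phi> \<Delta> \<G> i j) \<in> ratios \<Phi> \<Delta> \<G> i j" using finite_ratios by (rule Max_in[rotated])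
  then have "Max (ratios \<Phi> \<Delta> \<G> i j) \<ge> 1" using ratio_ge_1 by (auto simp: ratios_def)
  then show ?thesis using False by (simp add: max_ratio_def)
qed (simp add: max_ratio_def)

lemma eps_pos: "1 \<le> i \<Longrightarrow> i \<le> DIM('a) \<Longrightarrow> \<epsilon> i > 0"
proof (induction i rule: nat_induct_at_least)
  case base
  then show ?case using suitable by (simp add: suitable_list_def)
next
  case (Suc i)
  then have "\<epsilon> i < \<epsilon> (Suc i)" using suitable by (auto simp: suitable_list_def)
  then show ?case using Suc by simp
qed

lemma a_pos: "a > 0"
  using eps_pos[of "DIM('a)"] suitable by (simp add: suitable_list_def Suc_le_eq)

lemma eps_step:
  assumes "1 \<le> i" "i < DIM('a)"
  shows "2 * max_ratio \<Phi> \<Delta> \<G> (Suc i) i * \<epsilon> i < \<epsilon> (Suc i)"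
proof -
  have "Suc i \<in> {2..DIM('a)}" using assms by simp
  then have "2 * max_ratio \<Phi> \<Delta> \<G> (Suc i) (Suc i - 1) * \<epsilon> (Suc i - 1) < \<epsilon> (Suc i)"
    using suitable unfolding suitable_list_def by blast
  then show ?thesis by simp
qed

text \<open>Every \<open>max_ratio\<close> is at least 1, including the default value used when no
  pair of the given dimensions exists.\<close>

lemma eps_double:
  assumes "1 \<le> i" "i < DIM('a)"
  shows "2 * \<epsilon> i < \<epsilon> (Suc i)"
proof -
  have "2 * 1 * \<epsilon> i \<le> 2 * max_ratio \<Phi> \<Delta> \<G> (Suc i) i * \<epsilon> i"
    using max_ratio_ge_1 eps_pos[of i] assms by (intro mult_right_mono mult_left_mono) auto
  then show ?thesis using eps_step[OF assms] by linarith
qed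

text \<open>This serves sums of components, where no extension by a non-orthogonal root is
  available. Writing the dimension as d + Suc k, doubling gives 2 ^ Suc k * \<epsilon> d < a, and d
  + Suc k \<le> d * 2 ^ Suc k.\<close>

lemma eps_less:
  assumes "1 \<le> d" "d < DIM('a)"
  shows "\<epsilon> d < a / DIM('a) * d"
proof -
  have *: "2 ^ k * \<epsilon> d \<le> \<epsilon> (d + k)" if "d + k \<le> DIM('a)" for k
    using that
  proof (induction k)
    case (Suc k)
    then have "2 * \<epsilon> (d + k) < \<epsilon> (Suc (d + k))" using assms by (intro eps_double) auto
    then show ?case using Suc by simp
  qed simp
  obtain k where k: "DIM('a) = d + Suc k" using assms(2) by (metis add_Suc_right less_imp_Suc_add)
  have "2 ^ Suc k * \<epsilon> d \<le> 2 * \<epsilon> (d + k)" using *[of k] k by simp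
  also have "\<dots> < \<epsilon> (d + Suc k)" using eps_double[of "d + k"] assms k by simp
  also have "\<dots> = a" using suitable k by (simp add: suitable_list_def)
  finally have lt: "2 ^ Suc k * \<epsilon> d < a" .
  have "d + Suc k \<le> d * (1 + Suc k)" using assms by (cases d) auto
  also have "\<dots> \<le> d * 2 ^ Suc k" using less_exp[of "Suc k"] by (intro mult_left_mono) simp_all
  finally have "real DIM('a) \<le> real d * 2 ^ Suc k"
    unfolding k of_nat_le_iff[where 'a = real, symmetric] by simp
  then have "real DIM('a) * \<epsilon> d \<le> real d * 2 ^ Suc k * \<epsilon> d"
    using eps_pos[of d] assms by (intro mult_right_mono) auto
  also have "\<dots> < real d * a" using lt assms by simp
  finally show ?thesis by (simp add: field_simps)
qed

text \<open>The point is constant on the simple roots of each irreducible component of \<open>\<Phi>\<close>, scaled so that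
  a component of dimension \<open>d\<close> receives the share \<open>d / DIM('a)\<close> of \<open>a\<close>. If \<open>A\<close> arises from \<open>B\<close> by
  adding one simple root not orthogonal to \<open>B\<close>, then \<open>x \<bullet> \<pi>\<^sub>A \<le> 2 R x \<bullet> \<pi>\<^sub>B\<close>, and the condition on \<open>\<epsilon>\<close>
  passes from \<open>A\<close> to \<open>B\<close>; if there is no such root, \<open>B\<close> is a sum of components.\<close>

lemma interior_point:
  obtains x where "x \<bullet> \<delta> = a" "\<And>A. A \<in> G_fund \<Delta> \<G> - {UNIV} \<Longrightarrow> x \<bullet> pi_sub \<Phi> \<Delta> A > \<epsilon> (dim A)"
proof -
  define t where "t = weight (a / DIM('a))"
  have t0: "t \<gamma> \<ge> 0" if "\<gamma> \<in> \<Delta>" for \<gamma> unfolding t_def using a_pos that by (intro weight_nonneg) auto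
  obtain x where x: "\<And>\<gamma>. \<gamma> \<in> \<Delta> \<Longrightarrow> x \<bullet> \<gamma> = t \<gamma>" using exists_simple_values[of t] by blast
  have card: "card \<Delta> = DIM('a)"
    using simple_facts by (metis dim_UNIV dim_eq_card_independent dim_span)
  have inner_pi: "x \<bullet> pi_sub \<Phi> \<Delta> (span S) = (\<Sum>\<gamma>\<in>S. coeff (pi_sub \<Phi> \<Delta> (span S)) \<gamma> * t \<gamma>)" if "S \<subseteq> \<Delta>" for S
    unfolding inner_coeff[of x "pi_sub \<Phi> \<Delta> (span S)"]
    using that x coeff_pi_sub_zero[OF that] simple_facts(4) by (intro sum.mono_neutral_cong_right) auto
  have split: "x \<bullet> pi_sub \<Phi> \<Delta> (span S) = a / DIM('a) * card S"
    if S: "S \<subseteq> \<Delta>" and orth: "\<And>\<alpha> \<gamma>. \<alpha> \<in> \<Delta> - S \<Longrightarrow> \<gamma> \<in> S \<Longrightarrow> orthogonal \<alpha> \<gamma>" for S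
    unfolding inner_pi[OF S] using sum_weight_split[OF S orth] coeff_pi_sub_split[OF S orth]
    by (simp add: t_def)
  have "x \<bullet> \<delta> = a" using split[of \<Delta>] simple_facts(3) card by (simp add: delta_def)
  moreover have "x \<bullet> pi_sub \<Phi> \<Delta> B > \<epsilon> (dim B)" if "B \<in> G_fund \<Delta> \<G> - {UNIV}" for B
    using that
  proof (induction "DIM('a) - dim B" arbitrary: B rule: less_induct)
    case less
    then have B: "B \<in> G_fund \<Delta> \<G>" "B \<noteq> UNIV" by auto
    obtain S where S: "S \<subseteq> \<Delta>" "S \<noteq> {}" "B = span S" "\<Delta> \<inter> B = S" "dim B = card S" "B \<in> \<G>"
      using B(1) by (rule G_fundE)
    have finS: "finite S" using S(1) simple_facts(4) by (rule finite_subset)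
    have "S \<noteq> \<Delta>" using B(2) S(3) simple_facts(3) by auto
    then have d: "1 \<le> dim B" "dim B < DIM('a)"
      using S finS simple_facts(4) card by (auto simp: Suc_le_eq card_gt_0_iff psubset_card_mono[of \<Delta> S] psubset_eq simp flip: card)
    show ?case
    proof (cases "\<forall>\<alpha>\<in>\<Delta> - S. \<forall>\<gamma>\<in>S. orthogonal \<alpha> \<gamma>")
      case True
      then show ?thesis using split[OF S(1)] eps_less[OF d] S(3,5) by simp
    next
      case False
      then obtain \<alpha> \<gamma>0 where \<alpha>: "\<alpha> \<in> \<Delta>" "\<alpha> \<notin> S" "\<gamma>0 \<in> S" "\<not> orthogonal \<alpha> \<gamma>0" by blast
      define A where "A = span (insert \<alpha> S)"
      have AS: "insert \<alpha> S \<subseteq> \<Delta>" using \<alpha> S(1) by blast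
      have "A \<in> \<G>"
        unfolding A_def using S \<alpha> simple_facts(1)
        by (intro building_set_extend[OF roots building _ _ _ \<alpha>(3,4)]) auto
      then have A: "A \<in> G_fund \<Delta> \<G>" unfolding G_fund_def A_def using AS by blast
      have dimA: "dim A = Suc (dim B)"
        unfolding A_def using AS \<alpha>(2) finS S(5) simple_facts(2)
        by (metis card_insert_disjoint dim_eq_card_independent dim_span independent_mono)
      have BA: "B \<subset> A"
      proof
        show "B \<subseteq> A" unfolding A_def S(3) by (intro span_mono) blast
        show "B \<noteq> A" using dimA by (metis n_not_Suc_n)
      qed
      let ?R = "ratio \<Phi> \<Delta> A B"
      let ?b = "x \<bullet> pi_sub \<Phi> \<Delta> B"
      have R1: "?R \<ge> 1" using ratio_ge_1[OF A B(1)] BA by blast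
      have step: "coeff (pi_sub \<Phi> \<Delta> A) \<eta> * t \<eta> \<le> ?R * (coeff (pi_sub \<Phi> \<Delta> B) \<gamma> * t \<eta>)"
        if "\<eta> \<in> \<Delta>" "\<gamma> \<in> S" for \<eta> \<gamma>
        using mult_right_mono[OF coeff_le_ratio[OF B(1) that(1), of \<gamma> A] t0[OF that(1)]] that S(4)
        by (simp add: mult.assoc)
      have "x \<bullet> pi_sub \<Phi> \<Delta> A =
          coeff (pi_sub \<Phi> \<Delta> A) \<alpha> * t \<alpha> + (\<Sum>\<gamma>\<in>S. coeff (pi_sub \<Phi> \<Delta> A) \<gamma> * t \<gamma>)"
        using inner_pi[OF AS] \<alpha>(2) finS by (simp add: A_def)
      also have "(\<Sum>\<gamma>\<in>S. coeff (pi_sub \<Phi> \<Delta> A) \<gamma> * t \<gamma>) \<le> ?R * ?b"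
        unfolding S(3) inner_pi[OF S(1)] sum_distrib_left using step S(1,3) by (intro sum_mono) auto
      \<comment> \<open>As \<alpha> is linked to \<gamma>0, both have the same weight, so the term
        of the new root is bounded by \<open>?R\<close> times a single term of \<open>?b\<close>.
        Together with the sum over S this accounts for the factor 2 in the growth condition.\<close>
      also have "coeff (pi_sub \<Phi> \<Delta> A) \<alpha> * t \<alpha> \<le> ?R * (coeff (pi_sub \<Phi> \<Delta> B) \<gamma>0 * t \<gamma>0)"
        using step[OF \<alpha>(1,3)] weight_linked[of \<alpha> \<gamma>0] \<alpha> S(1) by (auto simp: t_def)
      also have "\<dots> \<le> ?R * ?b"
        unfolding S(3) inner_pi[OF S(1)]
        using R1 \<alpha>(3) finS S(1,3) t0 coeff_pi_sub_nonneg
        by (intro mult_left_mono member_le_sum) (auto intro!: mult_nonneg_nonneg)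
      finally have le: "x \<bullet> pi_sub \<Phi> \<Delta> A \<le> 2 * ?R * ?b" by simp
      \<comment> \<open>Only a weak inequality is available, since equality holds for the whole
        space. Strictness for B comes from \<open>eps_step\<close>.\<close>
      have "\<epsilon> (dim A) \<le> x \<bullet> pi_sub \<Phi> \<Delta> A"
      proof (cases "A = UNIV")
        case True
        then show ?thesis using \<open>x \<bullet> \<delta> = a\<close> suitable by (simp add: delta_def suitable_list_def)
      next
        case False
        then show ?thesis using less.hyps[of A] A dimA d by fastforce
      qed
      moreover have "2 * max_ratio \<Phi> \<Delta> \<G> (dim A) (dim B) * \<epsilon> (dim B) < \<epsilon> (dim A)"
        using eps_step[OF d] by (simp add: dimA)
      moreover have "2 * ?R * \<epsilon> (dim B) \<le> 2 * max_ratio \<Phi> \<Delta> \<G> (dim A) (dim B) * \<epsilon> (dim B)"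
        using ratio_le_max_ratio[OF A B(1) BA] eps_pos[of "dim B"] d
        by (intro mult_right_mono) auto
      ultimately have "2 * ?R * \<epsilon> (dim B) < 2 * ?R * ?b" using le by linarith
      then show ?thesis using R1 by (simp add: mult_less_cancel_left)
    qed
  qed
  ultimately show thesis using that by blast
qed

end


section \<open>Isometries permuting the fundamental nestohedra\<close>

context based_root_system
begin

text \<open>Each simple root \<eta> equals \<delta> minus its image under the reflection in \<eta>,
  and all differences \<delta> - w \<delta> have nonnegative coefficients. Hence
  \<open>nonneg_inverse_ray\<close> applies, with such differences as preimages of the simple
  roots.\<close>

lemma isometry_fixing_delta:
  assumes orth: "orthogonal_transformation g" and g\<delta>: "g \<delta> = \<delta>"
    and fwd: "\<And>w. w \<in> weyl_group \<Phi> \<Longrightarrow> \<exists>u\<in>weyl_group \<Phi>. g (w \<delta>) = u \<delta>"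
    and bwd: "\<And>u. u \<in> weyl_group \<Phi> \<Longrightarrow> \<exists>w\<in>weyl_group \<Phi>. g (w \<delta>) = u \<delta>"
    and \<alpha>: "\<alpha> \<in> \<Delta>"
  shows "g \<alpha> \<in> \<Delta>"
proof -
  have lin: "linear g" using orth by (rule orthogonal_transformation_linear)
  have inj: "inj g" using orth by (rule orthogonal_transformation_inj)
  have refl: "reflection \<eta> \<in> weyl_group \<Phi>" if "\<eta> \<in> \<Delta>" for \<eta>
    using that simple_facts(1) by (intro reflection_in_weyl_group) blast
  have nonneg: "coeff (\<delta> - w \<delta>) \<gamma> \<ge> 0" if "w \<in> weyl_group \<Phi>" for w \<gamma>
    using coeff_weyl_delta_le[OF weyl_group_Aut_roots[OF roots that]] by (simp add: coeff_diff)
  have simple_diff: "\<delta> - reflection \<eta> \<delta> = \<eta>" if "\<eta> \<in> \<Delta>" for \<eta>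
    by (simp add: reflection_delta[OF that])
  obtain u where u: "u \<in> weyl_group \<Phi>" "g (reflection \<alpha> \<delta>) = u \<delta>" using fwd[OF refl[OF \<alpha>]] by blast
  have "g \<alpha> = g (\<delta> - reflection \<alpha> \<delta>)" by (simp add: simple_diff[OF \<alpha>])
  also have "\<dots> = \<delta> - u \<delta>" using lin g\<delta> u(2) by (simp add: linear_diff)
  finally have g\<alpha>: "coeff (g \<alpha>) \<gamma> \<ge> 0" for \<gamma> using nonneg[OF u(1)] by simp
  have "\<exists>w\<in>weyl_group \<Phi>. g (\<delta> - w \<delta>) = \<eta>" if \<eta>: "\<eta> \<in> \<Delta>" for \<eta>
  proof -
    obtain w where "w \<in> weyl_group \<Phi>" "g (w \<delta>) = reflection \<eta> \<delta>" using bwd[OF refl[OF \<eta>]] by blast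
    then show ?thesis using lin g\<delta> simple_diff[OF \<eta>] by (metis linear_diff)
  qed
  then obtain w where w: "\<And>\<eta>. \<eta> \<in> \<Delta> \<Longrightarrow> w \<eta> \<in> weyl_group \<Phi>"
    "\<And>\<eta>. \<eta> \<in> \<Delta> \<Longrightarrow> g (\<delta> - w \<eta> \<delta>) = \<eta>" by metis
  obtain \<gamma> c where \<gamma>: "\<gamma> \<in> \<Delta>" "\<delta> - w \<gamma> \<delta> = c *\<^sub>R \<alpha>"
    by (rule nonneg_inverse_ray[OF lin inj \<alpha> g\<alpha> w(2) nonneg[OF w(1)]])
  have "c \<noteq> 0"
  proof
    assume "c = 0"
    then have "\<gamma> = 0" using w(2)[OF \<gamma>(1)] unfolding \<gamma>(2) by (simp add: linear_0[OF lin])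
    then show False using simple_nonzero[OF \<gamma>(1)] by blast
  qed
  have wd: "w \<gamma> \<delta> = \<delta> - c *\<^sub>R \<alpha>" using \<gamma>(2) by (simp add: algebra_simps)
  have "w \<gamma> \<delta> \<bullet> w \<gamma> \<delta> = \<delta> \<bullet> \<delta>"
    by (rule orthogonal_transformation_inner[OF orthogonal_transformation_weyl[OF w(1)[OF \<gamma>(1)]]])
  \<comment> \<open>Equality of the norms of \<delta> - c \<alpha> and \<delta>. With 2 (\<delta>
    \<bullet> \<alpha>) = \<alpha> \<bullet> \<alpha> and c nonzero it leaves c = 1.\<close>
  then have "c * (c * (\<alpha> \<bullet> \<alpha>)) = c * (2 * (\<delta> \<bullet> \<alpha>))"
    unfolding wd by (simp add: inner_diff_left inner_diff_right inner_commute algebra_simps)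
  then have "c = 1" using \<open>c \<noteq> 0\<close> delta_simple(1)[OF \<alpha>] simple_nonzero[OF \<alpha>] by simp
  then have "g \<alpha> = \<gamma>" using w(2)[OF \<gamma>(1)] \<gamma>(2) by simp
  then show ?thesis using \<gamma>(1) by simp
qed

text \<open>For a root w \<alpha> with \<alpha> simple, choose u with g (w \<delta>) = u \<delta>.
  Then \<open>g\<close>, preceded by w and followed by the inverse of u, fixes \<delta> and still
  permutes the orbit, so it sends \<alpha> to a simple root.\<close>

lemma orbit_permuting_isometry:
  assumes orth: "orthogonal_transformation g"
    and bwd: "\<And>u. u \<in> weyl_group \<Phi> \<Longrightarrow> \<exists>w\<in>weyl_group \<Phi>. g (w \<delta>) = u \<delta>"
  shows "g \<in> Aut_roots \<Phi>"
proof -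
  define orbit where "orbit = {w \<delta> | w. w \<in> weyl_group \<Phi>}"
  have fin: "finite orbit"
    unfolding orbit_def delta_half_sum using pos_root by (intro finite_weyl_orbit_half_sum) blast
  have inj: "inj g" using orth by (rule orthogonal_transformation_inj)
  \<comment> \<open>Every orbit point is the image of an orbit point; finiteness turns this covering
    into a permutation.\<close>
  have "orbit \<subseteq> g ` orbit"
  proof
    fix v assume "v \<in> orbit"
    then obtain u where u: "u \<in> weyl_group \<Phi>" "v = u \<delta>" unfolding orbit_def by blast
    obtain w where w: "w \<in> weyl_group \<Phi>" "g (w \<delta>) = u \<delta>" using bwd[OF u(1)] by blast
    have "w \<delta> \<in> orbit" unfolding orbit_def using w(1) by blast
    then show "v \<in> g ` orbit" unfolding u(2) w(2)[symmetric] by (rule imageI)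
  qed
  moreover have "card (g ` orbit) = card orbit" using inj by (meson card_image inj_on_subset subset_UNIV)
  ultimately have "g ` orbit = orbit" using fin by (metis card_subset_eq finite_imageI)
  then have fwd: "\<exists>u\<in>weyl_group \<Phi>. g (w \<delta>) = u \<delta>" if "w \<in> weyl_group \<Phi>" for w
  proof -
    have "g (w \<delta>) \<in> g ` orbit" unfolding orbit_def using that by blast
    then show ?thesis unfolding \<open>g ` orbit = orbit\<close> unfolding orbit_def by blast
  qed
  have "g \<beta> \<in> \<Phi>" if "\<beta> \<in> \<Phi>" for \<beta>
  proof -
    obtain w \<alpha> where w: "w \<in> weyl_group \<Phi>" "\<alpha> \<in> \<Delta>" "\<beta> = w \<alpha>" using root_conjugate_simple[OF \<open>\<beta> \<in> \<Phi>\<close>] by blast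
    obtain u where u: "u \<in> weyl_group \<Phi>" "g (w \<delta>) = u \<delta>" using fwd[OF w(1)] by blast
    define v where "v = inv_into UNIV u"
    have vW: "v \<in> weyl_group \<Phi>" unfolding v_def by (rule weyl_group_inv[OF u(1)])
    have "bij u" using u(1) by (intro orthogonal_transformation_bij orthogonal_transformation_weyl)
    then have uv: "u (v x) = x" "v (u x) = x" for x
      by (simp_all add: v_def bij_is_inj bij_is_surj surj_f_inv_f)
    define g' where "g' = v \<circ> (g \<circ> w)"
    have "g' \<alpha> \<in> \<Delta>"
    proof (rule isometry_fixing_delta[where g = g'])
      show "orthogonal_transformation g'"
        unfolding g'_def
        by (intro orthogonal_transformation_compose orth orthogonal_transformation_weyl[OF vW]
            orthogonal_transformation_weyl[OF w(1)])
      show "g' \<delta> = \<delta>" using u(2) uv by (simp add: g'_def)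
      show "\<exists>y\<in>weyl_group \<Phi>. g' (x \<delta>) = y \<delta>" if x: "x \<in> weyl_group \<Phi>" for x
      proof -
        obtain y where y: "y \<in> weyl_group \<Phi>" "g ((w \<circ> x) \<delta>) = y \<delta>"
          using fwd[OF weyl_group_comp[OF w(1) x]] by blast
        then have "g' (x \<delta>) = (v \<circ> y) \<delta>" by (simp add: g'_def)
        then show ?thesis using weyl_group_comp[OF vW y(1)] by blast
      qed
      show "\<exists>x\<in>weyl_group \<Phi>. g' (x \<delta>) = y \<delta>" if y: "y \<in> weyl_group \<Phi>" for y
      proof -
        obtain x where x: "x \<in> weyl_group \<Phi>" "g (x \<delta>) = (u \<circ> y) \<delta>"
          using bwd[OF weyl_group_comp[OF u(1) y]] by blast
        have "bij w" using w(1) by (intro orthogonal_transformation_bij orthogonal_transformation_weyl)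
        then have "w (inv_into UNIV w z) = z" for z by (simp add: bij_is_surj surj_f_inv_f)
        then have "g' ((inv_into UNIV w \<circ> x) \<delta>) = y \<delta>" using x(2) uv by (simp add: g'_def)
        then show ?thesis using weyl_group_comp[OF weyl_group_inv[OF w(1)] x(1)] by blast
      qed
    qed (fact w(2))
    then have "u (g' \<alpha>) \<in> \<Phi>"
      using simple_facts(1) Aut_rootsD(4)[OF weyl_group_Aut_roots[OF roots u(1)]] by blast
    then show ?thesis using uv by (simp add: g'_def w(3))
  qed
  then have "g ` \<Phi> \<subseteq> \<Phi>" by blast
  moreover have "inj_on g \<Phi>" using inj by (rule inj_on_subset) simp
  ultimately have "g ` \<Phi> = \<Phi>" using root_facts(1) by (simp add: endo_inj_surj)
  then show ?thesis
    using orth by (simp add: Aut_roots_def orthogonal_transformation_linear orthogonal_transformation_bij)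
qed

lemma eq_0_if_orthogonal_simple:
  assumes "\<And>\<alpha>. \<alpha> \<in> \<Delta> \<Longrightarrow> x \<bullet> \<alpha> = 0"
  shows "x = 0"
proof -
  have "x \<bullet> x = 0" using assms by (subst inner_coeff) simp
  then show ?thesis by simp
qed

text \<open>Simple reflections permute the orbit and so fix its sum, which is therefore orthogonal
  to every simple root.\<close>

lemma sum_weyl_orbit_delta: "(\<Sum>v\<in>{w \<delta> | w. w \<in> weyl_group \<Phi>}. v) = 0" (is "sum _ ?O = 0")
proof (rule eq_0_if_orthogonal_simple)
  fix \<alpha> assume \<alpha>: "\<alpha> \<in> \<Delta>"
  then have \<alpha>\<Phi>: "\<alpha> \<in> \<Phi>" using simple_facts(1) by blast
  have "reflection \<alpha> ` ?O \<subseteq> ?O"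
  proof clarify
    fix w assume "w \<in> weyl_group \<Phi>"
    then have "reflection \<alpha> \<circ> w \<in> weyl_group \<Phi>" using \<alpha>\<Phi> by (rule weyl_group.weyl_step)
    then show "\<exists>u. reflection \<alpha> (w \<delta>) = u \<delta> \<and> u \<in> weyl_group \<Phi>" by (metis comp_apply)
  qed
  moreover have inj: "inj_on (reflection \<alpha>) ?O"
    by (rule inj_on_inverseI[of _ "reflection \<alpha>"]) (rule reflection_involution)
  moreover have "finite ?O"
    unfolding delta_half_sum using pos_root by (intro finite_weyl_orbit_half_sum) blast
  ultimately have "reflection \<alpha> ` ?O = ?O" by (simp add: endo_inj_surj)
  then have "(\<Sum>v\<in>?O. reflection \<alpha> v) = (\<Sum>v\<in>?O. v)"
    using sum.reindex[OF inj, of "\<lambda>v. v"] by simp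
  then have "reflection \<alpha> (\<Sum>v\<in>?O. v) = (\<Sum>v\<in>?O. v)"
    by (simp add: linear_sum[OF linear_reflection])
  then show "(\<Sum>v\<in>?O. v) \<bullet> \<alpha> = 0"
    using simple_nonzero[OF \<alpha>] by (simp add: reflection_def)
qed

end

section \<open>The hyperplane spanned by the fundamental nestohedron\<close>

context suitable_system
begin

text \<open>On the hyperplane the condition for A reads y \<bullet> \<pi> \<ge> \<epsilon> (dim A)
  with \<pi> = \<open>pi_sub \<Phi> \<Delta> A\<close>. At the interior point these finitely many
  conditions are strict, hence stable under small moves.\<close>

lemma P_fund_neighbourhood:
  obtains x e where "x \<bullet> \<delta> = a" "e > 0" "\<And>y. y \<in> ball x e \<Longrightarrow> y \<bullet> \<delta> = a \<Longrightarrow> y \<in> P_fund \<Phi> \<Delta> \<G> \<epsilon> a"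
proof -
  obtain x where x: "x \<bullet> \<delta> = a" "\<And>A. A \<in> G_fund \<Delta> \<G> - {UNIV} \<Longrightarrow> x \<bullet> pi_sub \<Phi> \<Delta> A > \<epsilon> (dim A)"
    by (rule interior_point) blast
  define U where "U = (\<Inter>A\<in>G_fund \<Delta> \<G> - {UNIV}. {y. pi_sub \<Phi> \<Delta> A \<bullet> y > \<epsilon> (dim A)})"
  have "open U" unfolding U_def using finite_G_fund by (intro open_INT) (auto simp: open_halfspace_gt)
  moreover have "x \<in> U" using x(2) by (auto simp: U_def inner_commute)
  ultimately obtain e where e: "e > 0" "ball x e \<subseteq> U" using openE by blast
  have "y \<in> P_fund \<Phi> \<Delta> \<G> \<epsilon> a" if y: "y \<in> ball x e" "y \<bullet> \<delta> = a" for y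
  proof -
    have "y \<in> HS \<Phi> \<Delta> \<epsilon> a A" if A: "A \<in> G_fund \<Delta> \<G> - {UNIV}" for A
    proof -
      have "pi_sub \<Phi> \<Delta> A \<bullet> y > \<epsilon> (dim A)" using A y(1) e(2) unfolding U_def by blast
      then show ?thesis using A y(2) by (simp add: HS_def inner_diff_right inner_commute)
    qed
    then show ?thesis using y(2) by (simp add: P_fund_def)
  qed
  then show thesis using that x(1) e(1) by blast
qed

text \<open>Let d be the component of v orthogonal to \<delta>. A small move from the interior point
  in direction d stays in the polytope, so d \<bullet> v = 0; but d \<bullet> v = d \<bullet>
  d.\<close>

lemma P_fund_normal:
  assumes "\<And>y. y \<in> P_fund \<Phi> \<Delta> \<G> \<epsilon> a \<Longrightarrow> y \<bullet> v = b"
  obtains k where "v = k *\<^sub>R \<delta>" "b = k * a"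
proof -
  obtain x e where x: "x \<bullet> \<delta> = a" "e > 0"
    "\<And>y. y \<in> ball x e \<Longrightarrow> y \<bullet> \<delta> = a \<Longrightarrow> y \<in> P_fund \<Phi> \<Delta> \<G> \<epsilon> a"
    by (rule P_fund_neighbourhood) blast
  have \<delta>0: "\<delta> \<bullet> \<delta> \<noteq> 0" using x(1) a_pos by auto
  define k where "k = (v \<bullet> \<delta>) / (\<delta> \<bullet> \<delta>)"
  define d where "d = v - k *\<^sub>R \<delta>"
  have d\<delta>: "d \<bullet> \<delta> = 0" using \<delta>0 by (simp add: d_def k_def inner_diff_left)
  have "norm d + 1 > 0" using norm_ge_zero[of d] by linarith
  \<comment> \<open>Adding 1 avoids division by zero when d = 0, and halving e keeps the point
    inside the open ball.\<close>
  define s where "s = e / 2 / (norm d + 1)"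
  have s: "s > 0" unfolding s_def using x(2) \<open>norm d + 1 > 0\<close> by simp
  have "s * norm d \<le> s * (norm d + 1)" using s by simp
  also have "\<dots> = e / 2" using \<open>norm d + 1 > 0\<close> by (metis less_irrefl nonzero_eq_divide_eq s_def)
  also have "\<dots> < e" using x(2) by simp
  finally have "x + s *\<^sub>R d \<in> ball x e" using s by (simp add: dist_norm)
  moreover have "(x + s *\<^sub>R d) \<bullet> \<delta> = a" using x(1) d\<delta> by (simp add: inner_add_left)
  ultimately have "(x + s *\<^sub>R d) \<bullet> v = b" using assms x(3) by blast
  moreover have xb: "x \<bullet> v = b" using assms x by simp
  ultimately have "d \<bullet> v = 0" using s by (simp add: inner_add_left)
  then have "d \<bullet> d = 0" using d\<delta> by (subst (2) d_def) (simp add: inner_diff_right)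
  then have "v = k *\<^sub>R \<delta>" by (simp add: d_def)
  moreover from this have "b = k * a" using xb x(1) by simp
  ultimately show thesis using that by blast
qed

lemma isometry_permuting_P_fund:
  assumes dist: "\<And>x y. dist (g x) (g y) = dist x y"
    and perm: "(\<lambda>Q. g ` Q) ` {w ` P_fund \<Phi> \<Delta> \<G> \<epsilon> a | w. w \<in> weyl_group \<Phi>}
      = {w ` P_fund \<Phi> \<Delta> \<G> \<epsilon> a | w. w \<in> weyl_group \<Phi>}"
  shows "g \<in> Aut_roots \<Phi>"
proof -
  let ?P = "P_fund \<Phi> \<Delta> \<G> \<epsilon> a"
  define c where "c = g 0"
  define h where "h = (\<lambda>x. g x - c)"
  have orth: "orthogonal_transformation h"
    unfolding orthogonal_transformation_isometry using dist by (simp add: h_def c_def dist_norm)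
  \<comment> \<open>Some w satisfies u \<open>P = g\<close> w
    \<open>P. Pulling the equation of the hyperplane of u\<close> P back to P gives a normal v,
    which \<open>P_fund_normal\<close> makes a multiple of \<delta>; all maps involved preserve
    norms, so the factor is 1 or -1.\<close>
  have hyperplane: "\<exists>w\<in>weyl_group \<Phi>. \<exists>k. \<bar>k\<bar> = 1 \<and> u \<delta> = k *\<^sub>R h (w \<delta>) \<and> c \<bullet> u \<delta> = (1 - k) * a"
    if u: "u \<in> weyl_group \<Phi>" for u
  proof -
    have "u ` ?P \<in> (\<lambda>Q. g ` Q) ` {w ` ?P | w. w \<in> weyl_group \<Phi>}" unfolding perm using u by blast
    then obtain w where w: "w \<in> weyl_group \<Phi>" "u ` ?P = g ` w ` ?P" by blast
    define m where "m = h \<circ> w"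
    have m: "orthogonal_transformation m"
      unfolding m_def by (intro orthogonal_transformation_compose orth orthogonal_transformation_weyl[OF w(1)])
    define v where "v = inv_into UNIV m (u \<delta>)"
    have mv: "m v = u \<delta>" using orthogonal_transformation_surj[OF m] by (simp add: v_def surj_f_inv_f)
    note uo = orthogonal_transformation_weyl[OF u]
    have "y \<bullet> v = a - c \<bullet> u \<delta>" if y: "y \<in> ?P" for y
    proof -
      have "g (w y) \<in> u ` ?P" unfolding w(2) using y by blast
      then obtain z where z: "z \<in> ?P" "g (w y) = u z" by blast
      have "u z \<bullet> u \<delta> = a"
        using z(1) orthogonal_transformation_inner[OF uo] by (simp add: P_fund_def)
      then have "(m y + c) \<bullet> u \<delta> = a" using z(2) by (simp add: m_def h_def)
      then show ?thesis
        using orthogonal_transformation_inner[OF m, of y v] by (simp add: mv inner_add_left)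
    qed
    then obtain k where k: "v = k *\<^sub>R \<delta>" "a - c \<bullet> u \<delta> = k * a" by (rule P_fund_normal)
    have uk: "u \<delta> = k *\<^sub>R h (w \<delta>)"
      using mv k(1) orthogonal_transformation_scaleR[OF m] by (simp add: m_def)
    have "norm v = norm \<delta>"
      using mv orthogonal_transformation_norm[OF m] orthogonal_transformation_norm[OF uo] by metis
    moreover have "\<delta> \<noteq> 0"
      using interior_point a_pos by (metis inner_zero_right less_irrefl)
    ultimately have "\<bar>k\<bar> = 1" by (simp add: k(1))
    then show ?thesis using w(1) uk k(2) by (intro bexI[of _ w] exI[of _ k]) (auto simp: algebra_simps)
  qed
  let ?O = "{w \<delta> | w. w \<in> weyl_group \<Phi>}"
  have finO: "finite ?O"
    unfolding delta_half_sum using pos_root by (intro finite_weyl_orbit_half_sum) blast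
  have nonneg: "c \<bullet> v \<ge> 0" if "v \<in> ?O" for v
  proof -
    obtain u where u: "u \<in> weyl_group \<Phi>" "v = u \<delta>" using \<open>v \<in> ?O\<close> by blast
    obtain k where "\<bar>k\<bar> = 1" "c \<bullet> u \<delta> = (1 - k) * a" using hyperplane[OF u(1)] by blast
    then show ?thesis using a_pos u(2) by simp
  qed
  have "(\<Sum>v\<in>?O. c \<bullet> v) = 0" using sum_weyl_orbit_delta by (simp flip: inner_sum_right)
  then have "\<forall>v\<in>?O. c \<bullet> v = 0"
    using sum_nonneg_eq_0_iff[OF finO, of "\<lambda>v. c \<bullet> v"] nonneg by blast
  then have c_orbit: "c \<bullet> w \<delta> = 0" if "w \<in> weyl_group \<Phi>" for w
    using that by blast
  have "c = 0"
  proof (rule eq_0_if_orthogonal_simple)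
    fix \<alpha> assume \<alpha>: "\<alpha> \<in> \<Delta>"
    then have "reflection \<alpha> \<in> weyl_group \<Phi>" using simple_facts(1) by (intro reflection_in_weyl_group) blast
    then have "c \<bullet> (\<delta> - \<alpha>) = 0" using c_orbit[of "reflection \<alpha>"] by (simp add: reflection_delta[OF \<alpha>])
    then show "c \<bullet> \<alpha> = 0" using c_orbit[OF weyl_group.weyl_id] by (simp add: inner_diff_right)
  qed
  then have gh: "h = g" by (simp add: h_def fun_eq_iff)
  show ?thesis
  proof (rule orbit_permuting_isometry)
    show "orthogonal_transformation g" using orth by (simp add: gh)
    fix u assume "u \<in> weyl_group \<Phi>"
    then obtain w k where "w \<in> weyl_group \<Phi>" "u \<delta> = k *\<^sub>R h (w \<delta>)" "c \<bullet> u \<delta> = (1 - k) * a"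
      using hyperplane by blast
    \<comment> \<open>Now (1 - k) a = 0, so k = 1 and the opposite normal is excluded.\<close>
    then show "\<exists>w\<in>weyl_group \<Phi>. g (w \<delta>) = u \<delta>" using a_pos \<open>c = 0\<close> gh by auto
  qed
qed

end

theorem theorem7p1:
  fixes \<Phi> \<Delta> :: "'a::euclidean_space set"
    and \<G> :: "'a set set"
    and \<epsilon> :: "nat \<Rightarrow> real"
    and a :: real
  assumes "root_system \<Phi>"
    and "normalized_roots \<Phi>"
    and "simple_roots \<Phi> \<Delta>"
    and "building_set \<Phi> \<G>"
    and "invariant_under (weyl_group \<Phi>) \<G>"
    and "UNIV \<in> \<G>"
    and "suitable_list \<Phi> \<Delta> \<G> \<epsilon> a"
    and "invariant_under (Aut_roots \<Phi>) \<G>"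
  shows "subgroup (Aut_roots \<Phi>) (isometry_group (permutonestohedron \<Phi> \<Delta> \<G> \<epsilon> a)) \<and>
    ((\<forall>g\<in>carrier (isometry_group (permutonestohedron \<Phi> \<Delta> \<G> \<epsilon> a)).
        (\<lambda>Q. g ` Q) ` {w ` P_fund \<Phi> \<Delta> \<G> \<epsilon> a | w. w \<in> weyl_group \<Phi>}
          = {w ` P_fund \<Phi> \<Delta> \<G> \<epsilon> a | w. w \<in> weyl_group \<Phi>})
     \<longrightarrow> Aut_roots \<Phi> = carrier (isometry_group (permutonestohedron \<Phi> \<Delta> \<G> \<epsilon> a)))"
proof (intro conjI impI)
  interpret suitable_system \<Phi> \<Delta> \<G> \<epsilon> a
    using assms by unfold_locales
  let ?P = "permutonestohedron \<Phi> \<Delta> \<G> \<epsilon> a"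
  show sub: "subgroup (Aut_roots \<Phi>) (isometry_group ?P)"
    by (rule Aut_roots_subgroup[OF assms(2,8)])
  assume perm: "\<forall>g\<in>carrier (isometry_group ?P).
        (\<lambda>Q. g ` Q) ` {w ` P_fund \<Phi> \<Delta> \<G> \<epsilon> a | w. w \<in> weyl_group \<Phi>}
          = {w ` P_fund \<Phi> \<Delta> \<G> \<epsilon> a | w. w \<in> weyl_group \<Phi>}"
  show "Aut_roots \<Phi> = carrier (isometry_group ?P)"
  proof
    show "Aut_roots \<Phi> \<subseteq> carrier (isometry_group ?P)" using sub by (rule subgroup.subset)
    show "carrier (isometry_group ?P) \<subseteq> Aut_roots \<Phi>"
    proof
      fix g assume g: "g \<in> carrier (isometry_group ?P)"
      then have "\<And>x y. dist (g x) (g y) = dist x y" by (simp add: isometry_group_def)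
      then show "g \<in> Aut_roots \<Phi>" using perm g by (intro isometry_permuting_P_fund) blast+
    qed
  qed
qed

end
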